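(* Let $F$, $\mathbf{K}_1$, $\mathbf{K}$, $\mathbf{D}(\mathbf{w})$, $\mathbf{H}(\mathbf{w})$, $\mathbf{Z}$, $\widehat{\mathbf{H}}(\mathbf{w})$ and the RFN algorithm be as in the context. Assume that $F$ is twice differentiable, $\gamma$-strongly convex and $L$-smooth, with $\gamma\mathbf{I}\preceq\mathbf{H}(\mathbf{w})\preceq L\mathbf{I}$ for all $\mathbf{w}\in\mathbb{R}^n$, and that $\|\mathbf{D}(\mathbf{w})\|\le\lambda_1<\infty$ for all $\mathbf{w}\in\mathbb{R}^n$. Let $\kappa=L/\gamma$, $\mathbf{w}^*=\arg\min_{\mathbf{w}\in\mathbb{R}^n}F(\mathbf{w})$, $0<\delta<1$, $0<\epsilon<1$, and $$\zeta = \lambda+\lambda_1\left\|\frac{\mathbf{Z}\mathbf{Z}^\top+\mu\mathbf{I}}{n}\right\|+\lambda_1\left\|\frac{\mathbf{K}_1+\mu\mathbf{I}}{n}\right\| .$$ If $\mathbf{w}_t\in\mathbb{R}^n$ is updated using the RFN algorithm, where $\widehat{\mathbf{H}}(\mathbf{w}_t)$ is constructed by sampling $$m=\Omega\left(\frac{\zeta^2 n\|\mathbf{K}_1\|}{\epsilon^2\gamma^2}\log\frac{\mathrm{Tr}(\mathbf{K}_1)}{\|\mathbf{K}_1\|\,\delta}\right)$$ random features, then with probability at least $1-\delta$ $$F(\mathbf{w}_{t+1})-F(\mathbf{w}^* )\le(1-\rho_t)\big(F(\mathbf{w}_t)-F(\mathbf{w}^* )\big),\qquad \rho_t=\frac{2\alpha_t\beta}{(1+\epsilon)\kappa}.$$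 Moreover, a step size $\alpha_t\le 2(1-\beta)(1-\epsilon)/\kappa$ is sufficient to pass the line search.
   Context: $\|\cdot\|$ is the spectral norm of a matrix (Euclidean norm of a vector); $\mathbf{A}\preceq\mathbf{B}$ means $\mathbf{B}-\mathbf{A}$ is positive semi-definite; $\Omega(\cdot)$ is the Big Omega notation of complexity theory ($m=\Omega(q)$ means that $m$ is at least a suitable constant multiple of $q$). Data: points $\mathbf{x}_1,\dots,\mathbf{x}_n\in\mathbb{R}^d$, outputs $y_1,\dots,y_n$, parameters $\lambda,\mu>0$, and a loss $\ell(y,u)$ twice differentiable in its second argument $u$ ($\ell''$ is the second derivative in $u$). Kernel: $p$ is a probability density with support in $\mathbb{R}^d$, $\phi(\mathbf{x},\boldsymbol{\omega})$ is a real-valued feature map with $|\phi(\mathbf{x},\boldsymbol{\omega})|\le 1$ everywhere, $k_1(\mathbf{x},\mathbf{x}')=\int\phi(\mathbf{x},\boldsymbol{\omega})\phi(\mathbf{x}',\boldsymbol{\omega})p(\boldsymbol{\omega})d\boldsymbol{\omega}$, and $\mathbf{K}_1=[k_1(\mathbf{x}_i,\mathbf{x}_j)]_{i,j=1}^n$. The gram matrix is $\mathbf{K}=\mathbf{K}_1+\mu\mathbf{I}$. Objective: $F(\mathbf{w})=\frac1n\sum_{i=1}^n\ell\big(y_i,[\mathbf{K}\mathbf{w}]_i\big)+\frac{\lambda}{2}\mathbf{w}^\top\mathbf{K}\mathbf{w}$ for $\mathbf{w}\in\mathbb{R}^n$. $\mathbf{D}(\mathbf{w})$ is the $n\times n$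 diagonal matrix with $[\mathbf{D}(\mathbf{w})]_{ii}=\ell''\big(y_i,[\mathbf{K}\mathbf{w}]_i\big)$, and the Hessian of $F$ is $\mathbf{H}(\mathbf{w})=\frac1n\mathbf{K}\mathbf{D}(\mathbf{w})\mathbf{K}+\lambda\mathbf{K}$. Random features: for $\boldsymbol{\omega}\in\mathbb{R}^d$, $\mathbf{z}(\boldsymbol{\omega})=[\phi(\mathbf{x}_1,\boldsymbol{\omega}),\dots,\phi(\mathbf{x}_n,\boldsymbol{\omega})]^\top$; for independent samples (random features) $\boldsymbol{\omega}_1,\dots,\boldsymbol{\omega}_m$ from $p$, $\mathbf{Z}=\frac{1}{\sqrt m}[\mathbf{z}(\boldsymbol{\omega}_1),\dots,\mathbf{z}(\boldsymbol{\omega}_m)]\in\mathbb{R}^{n\times m}$ and $$\widehat{\mathbf{H}}(\mathbf{w})=\frac1n(\mathbf{Z}\mathbf{Z}^\top+\mu\mathbf{I})\mathbf{D}(\mathbf{w})(\mathbf{Z}\mathbf{Z}^\top+\mu\mathbf{I})+\lambda(\mathbf{Z}\mathbf{Z}^\top+\mu\mathbf{I}).$$ RFN (random-feature based Newton) algorithm: at iteration $t$, sample $m$ independent random features from $p$, form $\widehat{\mathbf{H}}(\mathbf{w}_t)$, and set $\mathbf{w}_{t+1}=\mathbf{w}_t+\alpha_t\mathbf{p}_t$ with $\mathbf{p}_t=-[\widehat{\mathbf{H}}(\mathbf{w}_t)]^{-1}\nabla F(\mathbf{w}_t)$, where the step size $\alpha_t$ is selected by an Armijo-type line search such that $F(\mathbf{w}_t+\alpha_t\mathbf{p}_t)\le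 F(\mathbf{w}_t)+\alpha_t\beta\,\mathbf{p}_t^\top\nabla F(\mathbf{w}_t)$ for some $\beta\in(0,1)$.
   Formalization: The constant in Ω is 100(1+R)(1+1/ln(1/δ₀)) for any R ≥ μ/‖K₁‖ and δ ≤ δ₀ < 1; with a constant independent of μ/‖K₁‖ and of δ the claim is false (one point, zero loss, indicator feature of probability q→0, μ=1, δ=q/2). *)

theory Defs
  imports "HOL-Probability.Probability"
begin

definition spectral_norm :: "real^'n^'m \<Rightarrow> real" where
  "spectral_norm A = onorm (\<lambda>v. A *v v)"

definition psd :: "real^'n^'n \<Rightarrow> bool" where
  "psd A \<longleftrightarrow> transpose A = A \<and> (\<forall>v. 0 \<le> v \<bullet> (A *v v))"

definition loewner_le :: "real^'n^'n \<Rightarrow> real^'n^'n \<Rightarrow> bool"  (infix "\<preceq>" 50) where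
  "A \<preceq> B \<longleftrightarrow> psd (B - A)"

definition grad :: "('a::real_inner \<Rightarrow> real) \<Rightarrow> 'a \<Rightarrow> 'a" where
  "grad f w = (THE g. GDERIV f w :> g)"

definition strongly_convex :: "real \<Rightarrow> ('a::real_inner \<Rightarrow> real) \<Rightarrow> bool" where
  "strongly_convex c f \<longleftrightarrow> convex_on UNIV (\<lambda>w. f w - c / 2 * (norm w)\<^sup>2)"

definition smooth :: "real \<Rightarrow> ('a::real_inner \<Rightarrow> real) \<Rightarrow> bool" where
  "smooth L f \<longleftrightarrow> (\<forall>w. f differentiable (at w)) \<and> L-lipschitz_on UNIV (grad f)"

definition kernel1 ::
  "('x \<Rightarrow> real^'d \<Rightarrow> real) \<Rightarrow> (real^'d \<Rightarrow> real) \<Rightarrow> 'x \<Rightarrow> 'x \<Rightarrow> real" where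
  "kernel1 \<phi> p x x' = (LINT \<omega>|lborel. \<phi> x \<omega> * \<phi> x' \<omega> * p \<omega>)"

definition kernel_matrix ::
  "('x \<Rightarrow> real^'d \<Rightarrow> real) \<Rightarrow> (real^'d \<Rightarrow> real) \<Rightarrow> ('n \<Rightarrow> 'x) \<Rightarrow> real^'n^'n" where
  "kernel_matrix \<phi> p x = (\<chi> i j. kernel1 \<phi> p (x i) (x j))"

definition objective ::
  "('y \<Rightarrow> real \<Rightarrow> real) \<Rightarrow> ('n \<Rightarrow> 'y) \<Rightarrow> real \<Rightarrow> real^'n^'n \<Rightarrow> real^'n \<Rightarrow> real" where
  "objective l y lam K w =
     (1 / real CARD('n)) * (\<Sum>i\<in>UNIV. l (y i) ((K *v w) $ i)) + lam / 2 * (w \<bullet> (K *v w))"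

text \<open>The argument \<open>l''\<close> is the second derivative of the loss in its second argument.\<close>

definition loss_diag ::
  "('y \<Rightarrow> real \<Rightarrow> real) \<Rightarrow> ('n \<Rightarrow> 'y) \<Rightarrow> real^'n^'n \<Rightarrow> real^'n \<Rightarrow> real^'n^'n" where
  "loss_diag l'' y K w = (\<chi> i j. if i = j then l'' (y i) ((K *v w) $ i) else 0)"

text \<open>With the gram matrix for \<open>G\<close> this is the Hessian of the objective; with the random-feature
  approximation of the gram matrix for \<open>G\<close>, and the same \<open>D\<close>, it is the approximate Hessian.\<close>

definition hessian_form :: "real \<Rightarrow> real^'n^'n \<Rightarrow> real^'n^'n \<Rightarrow> real^'n^'n" where
  "hessian_form lam D G = (1 / real CARD('n)) *\<^sub>R (G ** D ** G) + lam *\<^sub>R G"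

definition feature_matrix ::
  "('x \<Rightarrow> 'w \<Rightarrow> real) \<Rightarrow> ('n \<Rightarrow> 'x) \<Rightarrow> ('m \<Rightarrow> 'w) \<Rightarrow> real^'m^'n" where
  "feature_matrix \<phi> x ws = (\<chi> i j. \<phi> (x i) (ws j) / sqrt (real CARD('m)))"

definition newton_direction :: "real^'n^'n \<Rightarrow> real^'n \<Rightarrow> real^'n" where
  "newton_direction H g = - (matrix_inv H *v g)"

definition armijo ::
  "('a::real_inner \<Rightarrow> real) \<Rightarrow> real \<Rightarrow> 'a \<Rightarrow> 'a \<Rightarrow> real \<Rightarrow> bool" where
  "armijo f \<beta> w d \<alpha> \<longleftrightarrow> f (w + \<alpha> *\<^sub>R d) \<le> f w + \<alpha> * \<beta> * (d \<bullet> grad f w)"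

text \<open>One iteration, from \<open>w\<close> to \<open>w'\<close> with step size \<open>\<alpha>\<close>, given the approximate Hessian \<open>Hh\<close> at \<open>w\<close>.\<close>

definition rfn_update ::
  "(real^'n \<Rightarrow> real) \<Rightarrow> real \<Rightarrow> real^'n^'n \<Rightarrow> real^'n \<Rightarrow> real \<Rightarrow> real^'n \<Rightarrow> bool" where
  "rfn_update f \<beta> Hh w \<alpha> w' \<longleftrightarrow>
     0 < \<alpha> \<and> armijo f \<beta> w (newton_direction Hh (grad f w)) \<alpha> \<and>
     w' = w + \<alpha> *\<^sub>R newton_direction Hh (grad f w)"

text \<open>The constant hidden in the Big Omega bound on the number of random features. It is uniform in
  the dimensions, the data, the kernel, the loss and all other parameters, as long as \<open>R\<close> bounds
  the ratio of \<open>\<mu>\<close> to the spectral norm of the kernel matrix and \<open>\<delta> \<le> \<delta>\<^sub>0 < 1\<close>. No constant works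
  uniformly over all ratios and all \<open>\<delta> < 1\<close>: for a single point whose feature is the indicator of an
  event of probability \<open>q\<close> and a zero loss, one random feature would be declared sufficient if
  \<open>q \<rightarrow> 0\<close> with \<open>\<delta> = q / 2\<close> and \<open>\<mu> = 1\<close>, or if \<open>\<delta> \<rightarrow> 1\<close> with \<open>q = 1 / 2\<close> and \<open>\<mu>\<close> small, and the
  claim fails in both cases. The definition writes out an explicit value because
  an existential quantifier could not range outside the types that carry the dimensions.\<close>

definition omega_const :: "real \<Rightarrow> real \<Rightarrow> real" where
  "omega_const R \<delta>\<^sub>0 = 100 * (1 + R) * (1 + 1 / ln (1 / \<delta>\<^sub>0))"

end

theory Submission
  imports Defs
begin

text \<open>Let \<open>X\<close> be the sum of the \<open>m\<close> centered matrices \<open>z z\<^sup>T - K\<^sub>1\<close>. Concentration of \<open>X\<close> comes from its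
  trace moments, without matrix exponentials: exchanging one sample for an independent copy and a mean
  value inequality for traces of odd powers bound the mean of \<open>tr X\<^sup>2\<^sup>p\<close> by
  \<open>(2p - 1) n\<close> times the mean of \<open>tr ((X + 2 m K\<^sub>1) X\<^sup>2\<^sup>p\<^sup>-\<^sup>2)\<close>. This recursion starts from
  \<open>2 n m tr K\<^sub>1\<close>, so that \<open>tr K\<^sub>1\<close> takes the place of a dimension factor, and Markov's inequality with \<open>p\<close> of
  the order of the logarithm in the sample size gives the tail bound.

  The accuracy needed is \<open>\<tau> = \<epsilon> \<gamma> / \<zeta>\<close>, since the two Hessians differ by at most \<open>\<zeta>\<close> times the error of
  the Gram matrix; \<open>\<tau>\<close> is at most \<open>(1 + R)\<close> times the norm of \<open>K\<^sub>1\<close> because \<open>\<gamma>\<close> is at most \<open>\<zeta>\<close> times the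
  norm of \<open>K\<close>. An approximate Hessian between \<open>(1 - \<epsilon>) H\<close> and \<open>(1 + \<epsilon>) H\<close> then yields the usual descent
  estimate.\<close>

section \<open>Symmetric matrices and traces of their powers\<close>

lemma symmetric_dot_commute:
  fixes A :: "real^'n^'n"
  assumes "transpose A = A"
  shows "u \<bullet> (A *v v) = (A *v u) \<bullet> v"
  by (metis assms dot_lmul_matrix vector_transpose_matrix)

text \<open>First-order optimality without derivatives: for small \<open>t\<close> a nonzero linear
  term would outgrow the quadratic one.\<close>

lemma eq_zero_of_linear_le_quadratic:
  fixes b c :: real
  assumes "\<And>t. 2 * t * b \<le> t\<^sup>2 * c"
  shows "b = 0"
proof (rule ccontr)
  assume b: "b \<noteq> 0"
  \<comment> \<open>The hypothesis at \<open>t = b / d\<close> gives \<open>2 * d \<le> c\<close>,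
    which \<open>0 < d\<close> and \<open>c < d\<close> exclude.\<close>
  define d where "d = 1 + \<bar>c\<bar>"
  have d: "0 < d" "c < d" by (auto simp: d_def)
  have "2 * b\<^sup>2 * d = (2 * (b / d) * b) * d\<^sup>2" using d by (simp add: power2_eq_square)
  also have "\<dots> \<le> ((b / d)\<^sup>2 * c) * d\<^sup>2" by (intro mult_right_mono assms) auto
  also have "\<dots> = b\<^sup>2 * c" using d by (simp add: power_divide)
  finally have "2 * d \<le> c" using b by simp
  with d show False by linarith
qed

text \<open>The Rayleigh quotient attains its maximum on the unit sphere of \<open>S\<close>, and a
  maximizer is an eigenvector. Its eigenvalue is the quotient itself, so it needs no witness of its
  own.\<close>

lemma symmetric_unit_eigenvector_exists:
  fixes A :: "real^'n^'n"
  assumes sym: "transpose A = A" and S: "subspace S" and inv: "\<And>v. v \<in> S \<Longrightarrow> A *v v \<in> S"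
    and ne: "S \<noteq> {0}"
  obtains u where "u \<in> S" "norm u = 1" "A *v u = (u \<bullet> (A *v u)) *\<^sub>R u"
proof -
  let ?q = "\<lambda>v. v \<bullet> (A *v v)"
  have comp: "compact (S \<inter> sphere 0 1)"
    by (intro closed_Int_compact closed_subspace S) auto
  obtain a where a: "a \<in> S" "a \<noteq> 0" using ne S subspace_0 by blast
  have "a /\<^sub>R norm a \<in> S \<inter> sphere 0 1" using a S by (auto simp: subspace_def)
  then have ne': "S \<inter> sphere 0 1 \<noteq> {}" by blast
  have cont: "continuous_on (S \<inter> sphere 0 1) ?q"
    by (intro continuous_intros linear_continuous_on) (auto simp: linear_linear)
  obtain u where u: "u \<in> S" "norm u = 1" and umax: "\<And>v. v \<in> S \<Longrightarrow> norm v = 1 \<Longrightarrow> ?q v \<le> ?q u"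
    using continuous_attains_sup[OF comp ne' cont] by auto
  have q_le: "?q v \<le> ?q u * (norm v)\<^sup>2" if "v \<in> S" for v
  proof (cases "v = 0")
    case False
    have "?q (v /\<^sub>R norm v) \<le> ?q u" 
      using that False S by (intro umax) (auto simp: subspace_def)
    moreover have "?q (v /\<^sub>R norm v) = ?q v / (norm v)\<^sup>2"
      by (simp add: matrix_vector_mult_scaleR power2_eq_square divide_inverse)
    ultimately show ?thesis using False by (simp add: pos_divide_le_eq)
  qed simp
  \<comment> \<open>Moving from the maximizer \<open>u\<close> in a direction \<open>w\<close>
    orthogonal to it cannot raise the quotient, so the first-order term vanishes.\<close>
  have orth: "w \<bullet> (A *v u) = 0" if w: "w \<in> S" "w \<bullet> u = 0" for w
  proof -
    let ?c = "?q u * (norm w)\<^sup>2 - ?q w"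
    have *: "2 * t * (w \<bullet> (A *v u)) \<le> t\<^sup>2 * ?c" for t
    proof -
      have "u + t *\<^sub>R w \<in> S" using u w S by (auto simp: subspace_def)
      then have "?q (u + t *\<^sub>R w) \<le> ?q u * (norm (u + t *\<^sub>R w))\<^sup>2" by (rule q_le)
      moreover have "?q (u + t *\<^sub>R w) = ?q u + 2 * t * (w \<bullet> (A *v u)) + t\<^sup>2 * ?q w"
        using symmetric_dot_commute[OF sym, of u w]
        by (simp add: matrix_vector_right_distrib matrix_vector_mult_scaleR inner_add
            power2_eq_square inner_commute algebra_simps)
      moreover have "(norm (u + t *\<^sub>R w))\<^sup>2 = 1 + t\<^sup>2 * (norm w)\<^sup>2"
        unfolding power2_norm_eq_inner using u w
        by (simp add: inner_add inner_commute power2_eq_square norm_eq_1)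
      ultimately show ?thesis by (simp add: algebra_simps)
    qed
    from * show ?thesis by (rule eq_zero_of_linear_le_quadratic)
  qed
  \<comment> \<open>The part of \<open>A *v u\<close> orthogonal to \<open>u\<close>. It lies in
    \<open>S\<close>, so \<open>orth\<close> applies to it and yields
    \<open>w \<bullet> w = 0\<close>.\<close>
  define w where "w = A *v u - ?q u *\<^sub>R u"
  have uu: "u \<bullet> u = 1" using u by (simp add: norm_eq_1)
  have wS: "w \<in> S" unfolding w_def using u inv S by (simp add: subspace_diff subspace_scale)
  have "u \<bullet> w = 0" unfolding w_def by (simp add: inner_diff_right uu)
  then have wu: "w \<bullet> u = 0" by (simp add: inner_commute)
  have "w \<bullet> w = w \<bullet> (A *v u) - ?q u * (w \<bullet> u)" unfolding w_def by (simp add: inner_diff_right)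
  then have "w = 0" using orth[OF wS wu] wu by simp
  then show thesis using that[of u] u unfolding w_def by simp
qed

text \<open>Eigenvalues are not stored; the one belonging to \<open>b\<close> is read off as
  \<open>b \<bullet> (A *v b)\<close>.\<close>

definition orthonormal_eigenbasis :: "real^'n^'n \<Rightarrow> (real^'n) set \<Rightarrow> bool" where
  "orthonormal_eigenbasis A B \<longleftrightarrow> finite B \<and> pairwise orthogonal B \<and> span B = UNIV \<and>
     (\<forall>b\<in>B. norm b = 1 \<and> A *v b = (b \<bullet> (A *v b)) *\<^sub>R b)"

text \<open>Spectral theorem by induction on the dimension: by symmetry, the vectors of
  \<open>S\<close> orthogonal to a unit eigenvector form a smaller invariant subspace.\<close>

lemma symmetric_eigenbasis_subspace:
  fixes A :: "real^'n^'n"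
  assumes sym: "transpose A = A"
  shows "subspace S \<Longrightarrow> (\<And>v. v \<in> S \<Longrightarrow> A *v v \<in> S) \<Longrightarrow>
    \<exists>B. finite B \<and> pairwise orthogonal B \<and> span B = S \<and>
      (\<forall>b\<in>B. norm b = 1 \<and> A *v b = (b \<bullet> (A *v b)) *\<^sub>R b)"
proof (induction "dim S" arbitrary: S rule: less_induct)
  case less
  show ?case
  proof (cases "S = {0}")
    case True
    then show ?thesis by (intro exI[of _ "{}"]) auto
  next
    case False
    obtain u where u: "u \<in> S" "norm u = 1" "A *v u = (u \<bullet> (A *v u)) *\<^sub>R u"
      using symmetric_unit_eigenvector_exists[OF sym less.prems(1,2) False] by blast
    have uu: "u \<bullet> u = 1" using u by (simp add: norm_eq_1)
    let ?T = "S \<inter> {v. u \<bullet> v = 0}"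
    have sT: "subspace ?T" by (intro subspace_inter less.prems(1) subspace_hyperplane)
    have uT: "u \<notin> ?T" using uu by simp
    have "?T \<subset> S" using u uT by blast
    moreover have "dim ?T \<noteq> dim S"
      using subspace_dim_equal[OF sT less.prems(1)] uT u(1) by force
    ultimately have dim: "dim ?T < dim S"
      by (metis dim_subset nless_le psubset_imp_subset)
    have invT: "A *v v \<in> ?T" if "v \<in> ?T" for v
    proof -
      have "u \<bullet> (A *v v) = (u \<bullet> (A *v u)) * (u \<bullet> v)"
        by (metis inner_scaleR_left symmetric_dot_commute[OF sym] u(3))
      then show ?thesis using that less.prems(2) by auto
    qed
    obtain B where B: "finite B" "pairwise orthogonal B" "span B = ?T"
      "\<forall>b\<in>B. norm b = 1 \<and> A *v b = (b \<bullet> (A *v b)) *\<^sub>R b"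
      using less.hyps[OF dim sT invT] by blast
    have BT: "B \<subseteq> ?T" using B(3) span_superset by blast
    have "span (insert u B) = S"
    proof
      show "span (insert u B) \<subseteq> S"
        using BT u less.prems(1) by (intro span_minimal) auto
      show "S \<subseteq> span (insert u B)"
      proof
        fix v assume v: "v \<in> S"
        have "v - (u \<bullet> v) *\<^sub>R u \<in> ?T"
          using v u less.prems(1) by (auto simp: subspace_diff subspace_scale inner_diff_right uu)
        then have "v - (u \<bullet> v) *\<^sub>R u \<in> span B" using B by simp
        then show "v \<in> span (insert u B)" by (auto simp: span_insert)
      qed
    qed
    moreover have "pairwise orthogonal (insert u B)"
      using B(2) BT by (auto simp: pairwise_insert orthogonal_def inner_commute)
    ultimately show ?thesis using B u by (intro exI[of _ "insert u B"]) auto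
  qed
qed

lemma symmetric_eigenbasis_exists:
  fixes A :: "real^'n^'n"
  assumes "transpose A = A"
  obtains B where "orthonormal_eigenbasis A B"
  using symmetric_eigenbasis_subspace[OF assms subspace_UNIV] unfolding orthonormal_eigenbasis_def by auto

lemma orthonormal_eigenbasis_Parseval:
  assumes "orthonormal_eigenbasis A B"
  shows "(\<Sum>b\<in>B. (x \<bullet> b) * (y \<bullet> b)) = x \<bullet> y"
proof -
  have "(\<Sum>b\<in>B. (x \<bullet> b) *\<^sub>R b) = x"
    using assms unfolding orthonormal_eigenbasis_def by (intro orthonormal_basis_expand) auto
  then have "x \<bullet> y = (\<Sum>b\<in>B. (x \<bullet> b) *\<^sub>R b) \<bullet> y" by simp
  also have "\<dots> = (\<Sum>b\<in>B. (x \<bullet> b) * (y \<bullet> b))"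
    by (simp add: inner_sum_left inner_commute[of y])
  finally show ?thesis by simp
qed

text \<open>Basis independence of the trace: after expansion in coordinates the sums are swapped,
  and Parseval's identity leaves the diagonal entries.\<close>

lemma orthonormal_eigenbasis_trace:
  fixes A M :: "real^'n^'n"
  assumes "orthonormal_eigenbasis A B"
  shows "trace M = (\<Sum>b\<in>B. b \<bullet> (M *v b))"
proof -
  have "(\<Sum>b\<in>B. b \<bullet> (M *v b)) = (\<Sum>b\<in>B. \<Sum>i\<in>UNIV. (axis i 1 \<bullet> b) * ((M $ i) \<bullet> b))"
    by (simp add: inner_vec_def[of _ "M *v _"] matrix_vector_mul_component inner_axis' )
  also have "\<dots> = (\<Sum>i\<in>UNIV. axis i 1 \<bullet> (M $ i))"
    by (subst sum.swap) (simp add: orthonormal_eigenbasis_Parseval[OF assms])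
  finally show ?thesis by (simp add: trace_def inner_axis')
qed

section \<open>Powers of a matrix and their traces in eigenbases\<close>

primrec mpow :: "real^'n^'n \<Rightarrow> nat \<Rightarrow> real^'n^'n" where
  "mpow A 0 = mat 1"
| "mpow A (Suc k) = A ** mpow A k"

lemma mpow_Suc_right: "mpow A (Suc k) = mpow A k ** A"
proof (induction k)
  case (Suc k)
  have "mpow A (Suc (Suc k)) = A ** (mpow A k ** A)" unfolding Suc[symmetric] by simp
  then show ?case by (simp add: matrix_mul_assoc)
qed simp

lemma transpose_mpow: "transpose A = A \<Longrightarrow> transpose (mpow A k) = mpow A k"
proof (induction k)
  case (Suc k)
  then have "transpose (mpow A k ** A) = A ** mpow A k" by (simp add: matrix_transpose_mul)
  then show ?case by (metis mpow.simps(2) mpow_Suc_right)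
qed simp

lemma mpow_eigenvector:
  assumes "A *v b = c *\<^sub>R b"
  shows "mpow A k *v b = c ^ k *\<^sub>R b"
  by (induction k)
    (simp_all add: assms matrix_vector_mul_assoc[symmetric] matrix_vector_mult_scaleR)

lemma orthonormal_eigenbasis_mpow:
  assumes "orthonormal_eigenbasis A B" "b \<in> B"
  shows "mpow A k *v b = (b \<bullet> (A *v b)) ^ k *\<^sub>R b"
  using assms unfolding orthonormal_eigenbasis_def by (intro mpow_eigenvector) auto

lemma trace_mult_mpow:
  assumes B: "orthonormal_eigenbasis A B"
  shows "trace (M ** mpow A k) = (\<Sum>b\<in>B. (b \<bullet> (A *v b)) ^ k * (b \<bullet> (M *v b)))"
proof -
  have "b \<bullet> ((M ** mpow A k) *v b) = (b \<bullet> (A *v b)) ^ k * (b \<bullet> (M *v b))" if "b \<in> B" for b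
    by (simp add: matrix_vector_mul_assoc[symmetric] orthonormal_eigenbasis_mpow[OF B that]
        matrix_vector_mult_scaleR)
  then show ?thesis by (simp add: orthonormal_eigenbasis_trace[OF B])
qed

text \<open>This reduces trace inequalities for noncommuting matrices to scalar ones: pairs of
  eigenvalues enter as monomials, with the nonnegative weights
  \<open>(b \<bullet> c)\<^sup>2\<close>.\<close>

lemma trace_mpow_mult_mpow:
  fixes A C :: "real^'n^'n"
  assumes B: "orthonormal_eigenbasis A B" and C: "orthonormal_eigenbasis C B'"
    and symC: "transpose C = C"
  shows "trace (mpow C j ** mpow A k) =
    (\<Sum>b\<in>B. \<Sum>c\<in>B'. (b \<bullet> (A *v b)) ^ k * (c \<bullet> (C *v c)) ^ j * (b \<bullet> c)\<^sup>2)"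
proof -
  have "b \<bullet> (mpow C j *v b) = (\<Sum>c\<in>B'. (c \<bullet> (C *v c)) ^ j * (b \<bullet> c)\<^sup>2)" for b
  proof -
    have "(mpow C j *v b) \<bullet> c = (c \<bullet> (C *v c)) ^ j * (b \<bullet> c)" if "c \<in> B'" for c
    proof -
      have "(mpow C j *v b) \<bullet> c = b \<bullet> (mpow C j *v c)"
        by (rule symmetric_dot_commute[symmetric]) (simp add: transpose_mpow symC)
      also have "\<dots> = (c \<bullet> (C *v c)) ^ j * (b \<bullet> c)"
        by (simp add: orthonormal_eigenbasis_mpow[OF C that])
      finally show ?thesis .
    qed
    then have "(\<Sum>c\<in>B'. (b \<bullet> c) * ((mpow C j *v b) \<bullet> c)) = (\<Sum>c\<in>B'. (c \<bullet> (C *v c)) ^ j * (b \<bullet> c)\<^sup>2)"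
      by (intro sum.cong) (auto simp: power2_eq_square)
    then show ?thesis by (simp add: orthonormal_eigenbasis_Parseval[OF C])
  qed
  then show ?thesis
    by (simp add: trace_mult_mpow[OF B] sum_distrib_left mult.assoc)
qed

text \<open>The difference of powers is \<open>x - y\<close> times a sum of \<open>k + 1\<close>
  monomials. Adding the same sum in reversed form pairs the monomials, and each pair is at most
  \<open>x ^ k + y ^ k\<close>.\<close>

lemma power_mean_value_inequality:
  fixes x y :: real
  assumes "even k"
  shows "2 * ((x - y) * (x ^ Suc k - y ^ Suc k)) \<le> Suc k * ((x - y)\<^sup>2 * (x ^ k + y ^ k))"
proof -
  have *: "y ^ (k - i) * x ^ i + x ^ (k - i) * y ^ i \<le> x ^ k + y ^ k" if "i \<le> k" for i
  proof -
    \<comment> \<open>Both factors have the same sign by monotonicity of powers; evenness of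
      \<open>k\<close> removes the absolute values at the end.\<close>
    have "0 \<le> (\<bar>x\<bar> ^ (k - i) - \<bar>y\<bar> ^ (k - i)) * (\<bar>x\<bar> ^ i - \<bar>y\<bar> ^ i)"
    proof (cases "\<bar>x\<bar> \<le> \<bar>y\<bar>")
      case True
      then show ?thesis by (intro mult_nonpos_nonpos) (simp_all add: power_mono)
    next
      case False
      then show ?thesis by (intro mult_nonneg_nonneg) (simp_all add: power_mono)
    qed
    also have "\<dots> = \<bar>x\<bar> ^ k + \<bar>y\<bar> ^ k - \<bar>y ^ (k - i) * x ^ i\<bar> - \<bar>x ^ (k - i) * y ^ i\<bar>"
      using that by (simp add: algebra_simps abs_mult power_abs flip: power_add)
    finally show ?thesis using assms by (simp add: power_even_abs)
  qed
  let ?s = "\<Sum>i<Suc k. y ^ (Suc k - Suc i) * x ^ i" and ?s' = "\<Sum>i<Suc k. x ^ (Suc k - Suc i) * y ^ i"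
  have eq: "x ^ Suc k - y ^ Suc k = (x - y) * ?s" by (rule power_diff_sumr2)
  have eq': "x ^ Suc k - y ^ Suc k = (x - y) * ?s'"
    using power_diff_sumr2[of y "Suc k" x] by (simp add: algebra_simps)
  have "?s + ?s' = (\<Sum>i<Suc k. y ^ (k - i) * x ^ i + x ^ (k - i) * y ^ i)"
    by (simp add: sum.distrib)
  also have "\<dots> \<le> (\<Sum>i<Suc k. x ^ k + y ^ k)" by (intro sum_mono *) auto
  also have "\<dots> = Suc k * (x ^ k + y ^ k)" by simp
  finally have s: "?s + ?s' \<le> Suc k * (x ^ k + y ^ k)" .
  have "2 * ((x - y) * (x ^ Suc k - y ^ Suc k)) = (x - y) * ((x - y) * ?s) + (x - y) * ((x - y) * ?s')"
    unfolding eq[symmetric] eq'[symmetric] by simp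
  also have "\<dots> = (x - y)\<^sup>2 * (?s + ?s')"
    by (simp only: power2_eq_square distrib_left mult.assoc)
  also have "\<dots> \<le> (x - y)\<^sup>2 * (Suc k * (x ^ k + y ^ k))"
    by (intro mult_left_mono s) auto
  finally show ?thesis by (simp only: mult_ac)
qed

lemma matrix_diff_ldistrib: "(A::real^'n^'m) ** (B - C) = A ** B - A ** C"
  by (vector matrix_matrix_mult_def sum_subtractf right_diff_distrib)

lemma matrix_diff_rdistrib: "((A::real^'n^'m) - B) ** C = A ** C - B ** C"
  by (vector matrix_matrix_mult_def sum_subtractf left_diff_distrib)

lemma mpow_1 [simp]: "mpow A 1 = A" "mpow A (Suc 0) = A"
  by simp_all

lemma scaleR_matrix_mult_left: "(c *\<^sub>R (A::real^'n^'m)) ** B = c *\<^sub>R (A ** B)"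
  by (simp add: matrix_matrix_mult_def vec_eq_iff sum_distrib_left mult.assoc)

lemma scaleR_matrix_mult_right: "(A::real^'n^'m) ** (c *\<^sub>R B) = c *\<^sub>R (A ** B)"
  by (simp add: matrix_matrix_mult_def vec_eq_iff sum_distrib_left mult_ac)

lemma mpow_2: "mpow A 2 = A ** A"
  unfolding numeral_2_eq_2 by simp

text \<open>In orthonormal eigenbases of \<open>X\<close> and \<open>Y\<close> both sides become weighted sums over pairs of
  eigenvalues, with the same nonnegative weights, so that the scalar inequality suffices.\<close>

lemma trace_mean_value_inequality:
  fixes X Y :: "real^'n^'n"
  assumes X: "transpose X = X" and Y: "transpose Y = Y" and k: "even k"
  shows "2 * trace ((X - Y) ** (mpow X (Suc k) - mpow Y (Suc k))) \<le>
    Suc k * trace (((X - Y) ** (X - Y)) ** (mpow X k + mpow Y k))"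
proof -
  obtain B C where B: "orthonormal_eigenbasis X B" and C: "orthonormal_eigenbasis Y C"
    using symmetric_eigenbasis_exists X Y by metis
  let ?S = "\<lambda>f. \<Sum>b\<in>B. \<Sum>c\<in>C. f (b \<bullet> (X *v b)) (c \<bullet> (Y *v c)) * (b \<bullet> c)\<^sup>2 :: real"
  let ?e = "\<lambda>b. b \<bullet> (X *v b)" and ?f = "\<lambda>c. c \<bullet> (Y *v c)"
  have T: "trace (mpow Y j ** mpow X i) = ?S (\<lambda>x y. x ^ i * y ^ j)" for i j
    by (rule trace_mpow_mult_mpow[OF B C Y])
  have TX: "trace (mpow X i) = ?S (\<lambda>x y. x ^ i)" for i
    using T[of 0 i] by (simp only: mpow.simps(1) matrix_mul_lid power_0 mult_1_right)
  have TY: "trace (mpow Y i) = ?S (\<lambda>x y. y ^ i)" for i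
    using T[of i 0] by (simp only: mpow.simps(1) matrix_mul_rid power_0 mult_1_left)
  have YX: "trace (Y ** mpow X i) = ?S (\<lambda>x y. x ^ i * y)" for i
    using T[of 1 i] by (simp only: mpow_1 power_one_right)
  have XY: "trace (X ** mpow Y i) = ?S (\<lambda>x y. x * y ^ i)" for i
    using T[of i 1] by (simp only: mpow_1 power_one_right trace_mul_sym[of X])
  have YYX: "trace (Y ** Y ** mpow X i) = ?S (\<lambda>x y. x ^ i * y\<^sup>2)" for i
    using T[of 2 i] by (simp only: mpow_2)
  have XXY: "trace (X ** X ** mpow Y i) = ?S (\<lambda>x y. x\<^sup>2 * y ^ i)" for i
    using T[of i 2] by (simp only: mpow_2 trace_mul_sym[of "X ** X"])
  \<comment> \<open>\<open>X\<close> and \<open>Y\<close> need not commute; cyclicity of the trace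
    moves the leading \<open>X\<close> to the right, where it joins the power of
    \<open>X\<close>.\<close>
  have XYX: "trace (X ** Y ** mpow X i) = ?S (\<lambda>x y. x ^ Suc i * y)" for i
    unfolding YX[symmetric] mpow_Suc_right
    by (metis matrix_mul_assoc trace_mul_sym)
  have YXX: "trace (Y ** X ** mpow X i) = ?S (\<lambda>x y. x ^ Suc i * y)" for i
    unfolding YX[symmetric] by (simp add: matrix_mul_assoc)
  have YXY: "trace (Y ** X ** mpow Y i) = ?S (\<lambda>x y. x * y ^ Suc i)" for i
    unfolding XY[symmetric] mpow_Suc_right
    by (metis matrix_mul_assoc trace_mul_sym)
  have XYY: "trace (X ** Y ** mpow Y i) = ?S (\<lambda>x y. x * y ^ Suc i)" for i
    unfolding XY[symmetric] by (simp add: matrix_mul_assoc)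
  have XXX: "trace (X ** X ** mpow X i) = ?S (\<lambda>x y. x ^ Suc (Suc i))" for i
    unfolding TX[symmetric] by (simp add: matrix_mul_assoc)
  have YYY: "trace (Y ** Y ** mpow Y i) = ?S (\<lambda>x y. y ^ Suc (Suc i))" for i
    unfolding TY[symmetric] by (simp add: matrix_mul_assoc)
  have l: "trace ((X - Y) ** (mpow X (Suc k) - mpow Y (Suc k))) =
      ?S (\<lambda>x y. (x - y) * (x ^ Suc k - y ^ Suc k))"
  proof -
    have "trace ((X - Y) ** (mpow X (Suc k) - mpow Y (Suc k))) =
       trace (mpow X (Suc (Suc k))) - trace (X ** mpow Y (Suc k)) -
       (trace (Y ** mpow X (Suc k)) - trace (mpow Y (Suc (Suc k))))"
      unfolding mpow.simps(2)[of _ "Suc k"]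
      by (simp only: matrix_diff_ldistrib matrix_diff_rdistrib trace_sub)
    then show ?thesis
      unfolding TX TY XY YX
      by (simp add: sum_subtractf[symmetric] algebra_simps)
  qed
  have r: "trace (((X - Y) ** (X - Y)) ** (mpow X k + mpow Y k)) =
      ?S (\<lambda>x y. (x - y)\<^sup>2 * (x ^ k + y ^ k))"
  proof -
    have "trace (((X - Y) ** (X - Y)) ** (mpow X k + mpow Y k)) =
      trace (X ** X ** mpow X k) - trace (Y ** X ** mpow X k) - (trace (X ** Y ** mpow X k)
        - trace (Y ** Y ** mpow X k)) + (trace (X ** X ** mpow Y k) - trace (Y ** X ** mpow Y k)
        - (trace (X ** Y ** mpow Y k) - trace (Y ** Y ** mpow Y k)))"
      by (simp only: matrix_diff_ldistrib matrix_diff_rdistrib matrix_add_ldistrib trace_sub trace_add)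
    then show ?thesis
      unfolding XXX YXX XYX YYX XXY YXY XYY YYY
      by (simp add: sum_subtractf[symmetric] sum.distrib[symmetric] algebra_simps power2_eq_square)
  qed
  show ?thesis unfolding l r sum_distrib_left
  proof (intro sum_mono)
    fix b c
    show "2 * ((?e b - ?f c) * (?e b ^ Suc k - ?f c ^ Suc k) * (b \<bullet> c)\<^sup>2)
      \<le> Suc k * ((?e b - ?f c)\<^sup>2 * (?e b ^ k + ?f c ^ k) * (b \<bullet> c)\<^sup>2)"
      using mult_right_mono[OF power_mean_value_inequality[OF k, of "?e b" "?f c"] zero_le_power2[of "b \<bullet> c"]]
      by (simp only: mult.assoc)
  qed
qed

text \<open>An even power of \<open>X\<close> weighs the quadratic forms of \<open>M\<close> and
  \<open>N\<close> at the eigenvectors of \<open>X\<close> by nonnegative numbers.\<close>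

lemma trace_mult_mpow_mono:
  fixes X M N :: "real^'n^'n"
  assumes X: "transpose X = X" and k: "even k" and le: "\<And>v. v \<bullet> (M *v v) \<le> v \<bullet> (N *v v)"
  shows "trace (M ** mpow X k) \<le> trace (N ** mpow X k)"
proof -
  obtain B where B: "orthonormal_eigenbasis X B"
    using symmetric_eigenbasis_exists X by metis
  show ?thesis unfolding trace_mult_mpow[OF B]
    by (intro sum_mono mult_left_mono le zero_le_even_power k)
qed

text \<open>Eigenvalue by eigenvalue this is \<open>0 \<le> (x - c)\<^sup>2 * x ^ k\<close>. It
  trades the odd moment in the recursion for its two even neighbours.\<close>

lemma trace_mpow_odd_le:
  fixes X :: "real^'n^'n"
  assumes X: "transpose X = X" and k: "even k"
  shows "2 * (c * trace (mpow X (Suc k))) \<le> c\<^sup>2 * trace (mpow X k) + trace (mpow X (Suc (Suc k)))"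
proof -
  obtain B where B: "orthonormal_eigenbasis X B"
    using symmetric_eigenbasis_exists X by metis
  have T: "trace (mpow X i) = (\<Sum>b\<in>B. (b \<bullet> (X *v b)) ^ i)" for i
    using trace_mult_mpow[OF B, of "mat 1" i] B
    by (simp add: orthonormal_eigenbasis_def norm_eq_1)
  have "2 * (c * x ^ Suc k) \<le> c\<^sup>2 * x ^ k + x ^ Suc (Suc k)" for x :: real
  proof -
    have "0 \<le> (x - c)\<^sup>2 * x ^ k" using k by (simp add: zero_le_even_power)
    then show ?thesis by (simp add: power2_eq_square algebra_simps)
  qed
  then show ?thesis unfolding T sum_distrib_left sum.distrib[symmetric] by (intro sum_mono)
qed

text \<open>The trace of an even power is a sum of nonnegative terms, so it bounds each eigenvalue;
  Parseval's identity carries the bound over to all vectors.\<close>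

lemma spectral_norm_le_if_trace_mpow_le:
  fixes X :: "real^'n^'n"
  assumes X: "transpose X = X" and tr: "trace (mpow X (2 * k)) \<le> a ^ (2 * k)" and a: "0 \<le> a"
    and k: "0 < k"
  shows "spectral_norm X \<le> a"
proof -
  obtain B where B: "orthonormal_eigenbasis X B"
    using symmetric_eigenbasis_exists X by metis
  let ?e = "\<lambda>b. b \<bullet> (X *v b)"
  have T: "trace (mpow X i) = (\<Sum>b\<in>B. ?e b ^ i)" for i
    using trace_mult_mpow[OF B, of "mat 1" i] B
    by (simp add: orthonormal_eigenbasis_def norm_eq_1)
  have e: "(?e b)\<^sup>2 \<le> a\<^sup>2" if "b \<in> B" for b
  proof -
    have "(?e b) ^ (2 * k) \<le> a ^ (2 * k)"
      using member_le_sum[OF that, of "\<lambda>b. ?e b ^ (2 * k)"] B tr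
      by (simp add: T orthonormal_eigenbasis_def)
    then show ?thesis
      using k by (simp add: power_mult power_mono_iff)
  qed
  have "norm (X *v v) \<le> a * norm v" for v
  proof -
    have "(norm (X *v v))\<^sup>2 = (\<Sum>b\<in>B. ((X *v v) \<bullet> b)\<^sup>2)"
      using orthonormal_eigenbasis_Parseval[OF B, of "X *v v" "X *v v"]
      unfolding power2_norm_eq_inner by (simp add: power2_eq_square)
    also have "\<dots> = (\<Sum>b\<in>B. (?e b)\<^sup>2 * (v \<bullet> b)\<^sup>2)"
    proof (intro sum.cong refl)
      fix b assume b: "b \<in> B"
      have "(X *v v) \<bullet> b = v \<bullet> (X *v b)" by (simp add: symmetric_dot_commute[OF X])
      also have "X *v b = ?e b *\<^sub>R b" using B b by (simp add: orthonormal_eigenbasis_def)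
      finally show "((X *v v) \<bullet> b)\<^sup>2 = (?e b)\<^sup>2 * (v \<bullet> b)\<^sup>2" by (simp add: power_mult_distrib)
    qed
    also have "\<dots> \<le> (\<Sum>b\<in>B. a\<^sup>2 * (v \<bullet> b)\<^sup>2)"
      by (intro sum_mono mult_right_mono e) auto
    also have "\<dots> = (a * norm v)\<^sup>2"
      using orthonormal_eigenbasis_Parseval[OF B, of v v]
      unfolding power_mult_distrib power2_norm_eq_inner
      by (simp add: power2_eq_square flip: sum_distrib_left)
    finally show ?thesis using a by (simp add: power2_le_iff_abs_le)
  qed
  then show ?thesis unfolding spectral_norm_def by (intro onorm_le) (simp add: mult.commute)
qed

text \<open>For nonnegative eigenvalues the sum of squares is at most the square of the sum, so the
  preceding bound applies with exponent two.\<close>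

lemma spectral_norm_le_trace:
  fixes A :: "real^'n^'n"
  assumes A: "transpose A = A" and psd: "\<And>v. 0 \<le> v \<bullet> (A *v v)"
  shows "spectral_norm A \<le> trace A"
proof -
  obtain B where B: "orthonormal_eigenbasis A B"
    using symmetric_eigenbasis_exists A by metis
  let ?e = "\<lambda>b. b \<bullet> (A *v b)"
  have T: "trace (mpow A i) = (\<Sum>b\<in>B. ?e b ^ i)" for i
    using trace_mult_mpow[OF B, of "mat 1" i] B
    by (simp add: orthonormal_eigenbasis_def norm_eq_1)
  have tr: "trace A = sum ?e B" using T[of 1] by simp
  have le: "?e b \<le> trace A" if "b \<in> B" for b
    unfolding tr using B by (intro member_le_sum that psd) (auto simp: orthonormal_eigenbasis_def)
  have "trace (mpow A (2 * 1)) \<le> (\<Sum>b\<in>B. ?e b * trace A)"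
    unfolding T by (intro sum_mono) (simp add: power2_eq_square mult_left_mono psd le)
  also have "\<dots> = trace A ^ (2 * 1)"
    by (simp add: tr sum_distrib_right[symmetric] power2_eq_square)
  finally show ?thesis
    using spectral_norm_le_if_trace_mpow_le[OF A, of 1 "trace A"] by (simp add: tr sum_nonneg psd)
qed

section \<open>Moments of sums of independent random features\<close>

definition outer :: "real^'n \<Rightarrow> real^'n^'n" where
  "outer v = (\<chi> i j. v $ i * v $ j)"

lemma transpose_outer [simp]: "transpose (outer v) = outer v"
  by (simp add: outer_def transpose_def mult.commute)

lemma outer_mult_vec: "outer v *v u = (v \<bullet> u) *\<^sub>R v"
  by (simp add: outer_def matrix_vector_mult_def inner_vec_def vec_eq_iff sum_distrib_left
      sum_distrib_right mult_ac)

lemma borel_measurable_vec_lambda: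
  fixes f :: "'i::finite \<Rightarrow> 'a \<Rightarrow> 'b::euclidean_space"
  assumes "\<And>i. f i \<in> borel_measurable M"
  shows "(\<lambda>s. \<chi> i. f i s) \<in> borel_measurable M"
  using assms
  by (subst borel_measurable_euclidean_space) (auto simp: Basis_vec_def inner_axis)

lemma norm_square_le_card:
  fixes v :: "real^'n"
  assumes "\<And>i. \<bar>v $ i\<bar> \<le> 1"
  shows "(norm v)\<^sup>2 \<le> real CARD('n)"
proof -
  have "(norm v)\<^sup>2 = (\<Sum>i\<in>UNIV. (v $ i)\<^sup>2)"
    by (simp add: norm_vec_def L2_set_def sum_nonneg)
  also have "\<dots> \<le> (\<Sum>i\<in>(UNIV::'n set). 1)"
    by (intro sum_mono) (simp add: abs_square_le_1 assms)
  finally show ?thesis by simp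
qed

lemma trace_matrix_mult: "trace ((A::real^'n^'n) ** B) = (\<Sum>i\<in>UNIV. \<Sum>j\<in>UNIV. A $ i $ j * B $ j $ i)"
  by (simp add: trace_def matrix_matrix_mult_def)

lemma transpose_sum: "transpose (\<Sum>i\<in>I. f i :: real^'n^'n) = (\<Sum>i\<in>I. transpose (f i))"
  by (simp add: transpose_def vec_eq_iff)

lemma transpose_diff: "transpose (A - B :: real^'n^'n) = transpose A - transpose B"
  by (simp add: transpose_def vec_eq_iff)

lemma transpose_add: "transpose (A + B :: real^'n^'n) = transpose A + transpose B"
  by (simp add: transpose_def vec_eq_iff)

lemma trace_sum: "trace (\<Sum>i\<in>I. f i :: real^'n^'n) = (\<Sum>i\<in>I. trace (f i))"
  unfolding trace_def by (simp add: sum.swap[of _ I])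

lemma trace_scaleR: "trace (c *\<^sub>R A :: real^'n^'n) = c * trace A"
  unfolding trace_def by (simp add: sum_distrib_left)

lemma matrix_add_rdistrib: "((A::real^'n^'m) + B) ** C = A ** C + B ** C"
  by (vector matrix_matrix_mult_def sum.distrib[symmetric] distrib_right)

lemma matrix_mult_sum_left: "(\<Sum>i\<in>I. f i :: real^'n^'n) ** B = (\<Sum>i\<in>I. f i ** B)"
  by (induction I rule: infinite_finite_induct) (auto simp: matrix_add_rdistrib)

lemma continuous_on_matrix_mult [continuous_intros]:
  fixes A B :: "'a::topological_space \<Rightarrow> real^'n^'n"
  assumes "continuous_on S A" "continuous_on S B"
  shows "continuous_on S (\<lambda>v. A v ** B v)"
  unfolding matrix_matrix_mult_def by (intro continuous_intros assms)

lemma continuous_on_mpow [continuous_intros]: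
  "continuous_on S A \<Longrightarrow> continuous_on S (\<lambda>v. mpow (A v) k)"
  by (induction k) (auto intro: continuous_intros)

lemma continuous_on_trace [continuous_intros]:
  fixes A :: "'a::topological_space \<Rightarrow> real^'n^'n"
  shows "continuous_on S A \<Longrightarrow> continuous_on S (\<lambda>v. trace (A v))"
  unfolding trace_def by (intro continuous_intros)

lemma continuous_on_outer [continuous_intros]:
  "continuous_on S f \<Longrightarrow> continuous_on S (\<lambda>v. outer (f v))"
  unfolding outer_def by (intro continuous_intros)

text \<open>By |a - b|^2 <= 2 |a|^2 + 2 |b|^2 and the bound on the squared norms, the square of the
  difference is dominated by an expression linear in the two outer products.\<close>

lemma dot_diff_square_le:
  fixes v w u :: "real^'n"
  assumes v: "\<And>i. \<bar>v $ i\<bar> \<le> 1" and w: "\<And>i. \<bar>w $ i\<bar> \<le> 1"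
  shows "u \<bullet> (((outer v - outer w) ** (outer v - outer w)) *v u) \<le>
    u \<bullet> (((2 * real CARD('n)) *\<^sub>R (outer v + outer w)) *v u)"
proof -
  let ?D = "outer v - outer w"
  have "u \<bullet> ((?D ** ?D) *v u) = (?D *v u) \<bullet> (?D *v u)"
    using symmetric_dot_commute[of ?D u "?D *v u"]
    by (simp add: transpose_diff matrix_vector_mul_assoc)
  also have "?D *v u = (v \<bullet> u) *\<^sub>R v - (w \<bullet> u) *\<^sub>R w"
    by (simp add: matrix_vector_mult_diff_rdistrib outer_mult_vec)
  also have "(\<dots>) \<bullet> (\<dots>) \<le> 2 * (v \<bullet> u)\<^sup>2 * (norm v)\<^sup>2 + 2 * (w \<bullet> u)\<^sup>2 * (norm w)\<^sup>2"
  proof -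
    have "(a - b) \<bullet> (a - b) \<le> 2 * (a \<bullet> a) + 2 * (b \<bullet> b)" for a b :: "real^'n"
      using inner_ge_zero[of "a + b"] by (simp add: inner_add inner_diff inner_commute)
    from this[of "(v \<bullet> u) *\<^sub>R v" "(w \<bullet> u) *\<^sub>R w"] show ?thesis
      unfolding power2_norm_eq_inner by (simp add: power2_eq_square mult.assoc)
  qed
  also have "\<dots> \<le> 2 * (v \<bullet> u)\<^sup>2 * real CARD('n) + 2 * (w \<bullet> u)\<^sup>2 * real CARD('n)"
    by (intro add_mono mult_left_mono norm_square_le_card v w) auto
  also have "\<dots> = u \<bullet> (((2 * real CARD('n)) *\<^sub>R (outer v + outer w)) *v u)"
    by (simp add: scaleR_matrix_vector_assoc[symmetric] matrix_vector_mult_add_rdistrib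
        outer_mult_vec inner_add_right power2_eq_square inner_commute algebra_simps)
  finally show ?thesis .
qed

text \<open>The kernel and the density enter only through a bounded random vector \<open>z\<close>
  with second moment matrix \<open>K\<close>.\<close>

locale random_features = prob_space Q for Q :: "'w measure" +
  fixes z :: "'w \<Rightarrow> real^'n" and K :: "real^'n^'n"
  assumes z_measurable [measurable]: "z \<in> borel_measurable Q"
    and z_bound: "\<And>\<omega> i. \<bar>z \<omega> $ i\<bar> \<le> 1"
    and K_eq: "\<And>i j. K $ i $ j = (\<integral>\<omega>. z \<omega> $ i * z \<omega> $ j \<partial>Q)"
begin

text \<open>The index type is an arbitrary finite one, so that the same notion covers the sample
  alone and the sample with a ghost coordinate added. Statistics depend on a vector of vectors, for
  which continuity settles integrability.\<close>

definition feature_mean :: "((real^'n)^'i::finite \<Rightarrow> real) \<Rightarrow> real" where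
  "feature_mean g = (\<integral>\<omega>. g (\<chi> i. z (\<omega> i)) \<partial>(\<Pi>\<^sub>M i\<in>UNIV. Q))"

text \<open>The feature vectors stay in a compact cube, where a continuous statistic is bounded.
  General \<open>V\<close> and \<open>M\<close> cover both the product space and the original sample
  space.\<close>

lemma integrable_continuous_features:
  fixes g :: "(real^'n)^'i::finite \<Rightarrow> real"
  assumes g: "continuous_on UNIV g" and M: "prob_space M"
    and V: "\<And>i. V i \<in> borel_measurable M" and bound: "\<And>i s a. \<bar>V i s $ a\<bar> \<le> 1"
  shows "integrable M (\<lambda>s. g (\<chi> i. V i s))"
proof -
  interpret M: prob_space M by fact
  let ?C = "{v. \<forall>i a. \<bar>(v::(real^'n)^'i) $ i $ a\<bar> \<le> 1}"
  have "?C = (\<Inter>i. \<Inter>a. {v. \<bar>v $ i $ a\<bar> \<le> 1})" by auto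
  moreover have "closed {v::(real^'n)^'i. \<bar>v $ i $ a\<bar> \<le> 1}" for i a
    by (intro closed_Collect_le continuous_intros)
  ultimately have "closed ?C" by (auto intro!: closed_INT)
  moreover have "bounded ?C"
  proof (rule boundedI)
    fix v :: "(real^'n)^'i" assume v: "v \<in> ?C"
    have "norm v \<le> (\<Sum>i\<in>UNIV. norm (v $ i))" by (simp add: norm_vec_def L2_set_le_sum)
    also have "\<dots> \<le> (\<Sum>i\<in>(UNIV::'i set). real CARD('n))"
    proof (rule sum_mono)
      fix i
      have "norm (v $ i) \<le> (\<Sum>a\<in>UNIV. \<bar>v $ i $ a\<bar>)" by (rule norm_le_l1_cart)
      also have "\<dots> \<le> (\<Sum>a\<in>(UNIV::'n set). 1)" using v by (intro sum_mono) auto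
      finally show "norm (v $ i) \<le> real CARD('n)" by simp
    qed
    finally show "norm v \<le> real CARD('i) * real CARD('n)" by simp
  qed
  ultimately have "compact ?C" by (simp add: compact_eq_bounded_closed)
  then have "bounded (g ` ?C)"
    by (intro compact_imp_bounded compact_continuous_image continuous_on_subset[OF g]) auto
  then obtain B where B: "\<And>v. v \<in> ?C \<Longrightarrow> norm (g v) \<le> B" by (auto simp: bounded_iff)
  have [measurable]: "(\<lambda>s. \<chi> i. V i s) \<in> borel_measurable M"
    using V by (intro borel_measurable_vec_lambda)
  show ?thesis
  proof (rule M.integrable_const_bound)
    show "AE s in M. norm (g (\<chi> i. V i s)) \<le> B"
      by (intro AE_I2 B) (simp add: bound)
    show "(\<lambda>s. g (\<chi> i. V i s)) \<in> borel_measurable M"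
      using borel_measurable_continuous_onI[OF g] by measurable
  qed
qed

lemma prob_space_product: "prob_space (\<Pi>\<^sub>M i\<in>I. Q)"
  by (intro prob_space_PiM prob_space_axioms)

lemma feature_mean_integrable:
  fixes g :: "_ \<Rightarrow> real"
  shows "continuous_on UNIV g \<Longrightarrow> integrable (\<Pi>\<^sub>M i\<in>UNIV. Q) (\<lambda>\<omega>. g (\<chi> i. z (\<omega> i)))"
  by (rule integrable_continuous_features[where g = g and V = "\<lambda>i \<omega>. z (\<omega> i)" for g])
    (auto intro: prob_space_product z_bound)

lemma feature_mean_add:
  "continuous_on UNIV f \<Longrightarrow> continuous_on UNIV g \<Longrightarrow> feature_mean (\<lambda>v. f v + g v) = feature_mean f + feature_mean g"
  unfolding feature_mean_def by (intro Bochner_Integration.integral_add feature_mean_integrable)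

lemma feature_mean_diff:
  "continuous_on UNIV f \<Longrightarrow> continuous_on UNIV g \<Longrightarrow> feature_mean (\<lambda>v. f v - g v) = feature_mean f - feature_mean g"
  unfolding feature_mean_def by (intro Bochner_Integration.integral_diff feature_mean_integrable)

lemma feature_mean_cmult: "feature_mean (\<lambda>v. c * f v) = c * feature_mean f"
  unfolding feature_mean_def by simp

lemma feature_mean_sum:
  "(\<And>i. i \<in> I \<Longrightarrow> continuous_on UNIV (f i)) \<Longrightarrow> feature_mean (\<lambda>v. \<Sum>i\<in>I. f i v) = (\<Sum>i\<in>I. feature_mean (f i))"
  unfolding feature_mean_def by (intro Bochner_Integration.integral_sum feature_mean_integrable)

lemma feature_mean_mono:
  assumes "continuous_on UNIV f" "continuous_on UNIV g"
    and "\<And>v. (\<And>i a. \<bar>v $ i $ a\<bar> \<le> 1) \<Longrightarrow> f v \<le> g v"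
  shows "feature_mean f \<le> feature_mean g"
  unfolding feature_mean_def by (intro integral_mono feature_mean_integrable assms) (simp add: z_bound)

text \<open>With \<open>t\<close> a transposition this is exchangeability; with
  \<open>t = Some\<close> it discards the ghost coordinate.\<close>

lemma feature_mean_reindex:
  fixes g :: "(real^'n)^'i::finite \<Rightarrow> real" and t :: "'i \<Rightarrow> 'j::finite"
  assumes t: "inj t" and g: "continuous_on UNIV g"
  shows "feature_mean (\<lambda>v. g (\<chi> i. v $ t i)) = feature_mean g"
proof -
  let ?P = "\<Pi>\<^sub>M i\<in>UNIV. Q" and ?T = "\<lambda>\<omega>. \<lambda>n\<in>UNIV. \<omega> (t n)"
  have P: "distr ?P ?P ?T = ?P"
    using t by (intro distr_PiM_reindex) (auto intro: prob_space_axioms)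
  have "feature_mean g = (\<integral>\<omega>. g (\<chi> i. z (\<omega> i)) \<partial>distr ?P ?P ?T)"
    unfolding P by (simp add: feature_mean_def)
  also have "\<dots> = (\<integral>\<omega>. g (\<chi> i. z (?T \<omega> i)) \<partial>?P)"
  proof (rule integral_distr)
    show "?T \<in> ?P \<rightarrow>\<^sub>M ?P" by measurable
    show "(\<lambda>\<omega>. g (\<chi> i. z (\<omega> i))) \<in> borel_measurable ?P"
      using feature_mean_integrable[OF g] by auto
  qed
  finally show ?thesis by (simp add: feature_mean_def)
qed

text \<open>Fubini's theorem splits off the coordinate \<open>None\<close>, which is independent of
  the others and has second moments \<open>K\<close>.\<close>

lemma feature_mean_ghost_factor:
  fixes g :: "(real^'n)^'m::finite \<Rightarrow> real"
  assumes g: "continuous_on UNIV g"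
  shows "feature_mean (\<lambda>v::(real^'n)^'m option. v $ None $ a * v $ None $ b * g (\<chi> j. v $ Some j)) =
    K $ a $ b * feature_mean (\<lambda>v::(real^'n)^'m option. g (\<chi> j. v $ Some j))"
proof -
  interpret product_sigma_finite "\<lambda>_::'m option. Q"
    by unfold_locales
  let ?P = "\<lambda>I::'m option set. \<Pi>\<^sub>M i\<in>I. Q"
  have U: "insert None (range Some) = (UNIV::'m option set)"
    by (auto intro: option.exhaust simp: UNIV_option_conv)
  have *: "feature_mean (\<lambda>v::(real^'n)^'m option. h (v $ None) * g (\<chi> j. v $ Some j)) =
      (\<integral>y. h (z y) \<partial>Q) * (\<integral>x. g (\<chi> j. z (x (Some j))) \<partial>?P (range Some))"
    if h: "continuous_on UNIV h" for h :: "real^'n \<Rightarrow> real"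
  proof -
    have cont: "continuous_on UNIV (\<lambda>v::(real^'n)^'m option. h (v $ None) * g (\<chi> j. v $ Some j))"
      by (intro continuous_on_mult continuous_on_compose2[OF h] continuous_on_compose2[OF g]
          continuous_intros) auto
    have "feature_mean (\<lambda>v::(real^'n)^'m option. h (v $ None) * g (\<chi> j. v $ Some j)) =
        (\<integral>\<omega>. h (z (\<omega> None)) * g (\<chi> j. z (\<omega> (Some j))) \<partial>?P (insert None (range Some)))"
      unfolding U by (simp add: feature_mean_def)
    also have "\<dots> = (\<integral>x. (\<integral>y. h (z ((x(None := y)) None)) * g (\<chi> j. z ((x(None := y)) (Some j))) \<partial>Q)
        \<partial>?P (range Some))"
      using feature_mean_integrable[OF cont] by (intro product_integral_insert) (auto simp: U)
    also have "\<dots> = (\<integral>x. (\<integral>y. h (z y) \<partial>Q) * g (\<chi> j. z (x (Some j))) \<partial>?P (range Some))"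
      by simp
    also have "\<dots> = (\<integral>y. h (z y) \<partial>Q) * (\<integral>x. g (\<chi> j. z (x (Some j))) \<partial>?P (range Some))"
      by (rule integral_mult_right_zero)
    finally show ?thesis .
  qed
  have "continuous_on UNIV (\<lambda>v::real^'n. v $ a * v $ b)" by (intro continuous_intros)
  \<comment> \<open>The instance with the constant 1 identifies the remaining integral over the
    samples as a feature mean.\<close>
  from *[OF this] *[of "\<lambda>_. 1"] show ?thesis by (simp add: K_eq prob_space)
qed

text \<open>The ghost sample is independent of \<open>G\<close>, so its outer product may be
  averaged entry by entry. The exchange argument uses this in both directions.\<close>

lemma feature_mean_ghost_outer:
  fixes G :: "(real^'n)^'m::finite \<Rightarrow> real^'n^'n"
  assumes G: "continuous_on UNIV G"
  shows "feature_mean (\<lambda>v::(real^'n)^'m option. trace (outer (v $ None) ** G (\<chi> j. v $ Some j))) =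
    feature_mean (\<lambda>v::(real^'n)^'m option. trace (K ** G (\<chi> j. v $ Some j)))"
proof -
  have c: "continuous_on UNIV (\<lambda>u. G u $ b $ a)" for a b
    by (intro continuous_intros G)
  have c': "continuous_on UNIV (\<lambda>v::(real^'n)^'m option. G (\<chi> j. v $ Some j) $ b $ a)" for a b
    by (intro continuous_on_compose2[OF c] continuous_intros) auto
  show ?thesis
    by (simp add: trace_matrix_mult outer_def feature_mean_sum feature_mean_cmult c' continuous_intros
        feature_mean_ghost_factor[OF c])
qed

section \<open>Moments of the centered sum\<close>

definition centered_sum :: "(real^'n)^'m::finite \<Rightarrow> real^'n^'n" where
  "centered_sum u = (\<Sum>j\<in>UNIV. outer (u $ j) - K)"

lemma continuous_on_centered_sum [continuous_intros]:
  "continuous_on S f \<Longrightarrow> continuous_on S (\<lambda>v. centered_sum (f v))"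
  unfolding centered_sum_def by (intro continuous_intros)

lemma transpose_K: "transpose K = K"
  by (simp add: transpose_def vec_eq_iff K_eq mult.commute)

lemma transpose_centered_sum: "transpose (centered_sum u) = centered_sum u"
  by (simp add: centered_sum_def transpose_sum transpose_diff transpose_K)

text \<open>Write \<open>h\<^sub>j\<close> for the outer product of the \<open>j\<close>-th feature vector, \<open>h\<^sub>0\<close> for that of the ghost sample
  \<open>None\<close>, and \<open>X'\<close> for \<open>X\<close> with these two samples exchanged. By exchangeability the mean of
  \<open>tr ((h\<^sub>j - K) X\<^sup>q)\<close> is half that of \<open>tr ((h\<^sub>j - h\<^sub>0) (X\<^sup>q - X'\<^sup>q))\<close>, and since \<open>X - X' = h\<^sub>j - h\<^sub>0\<close> the mean
  value inequality applies.\<close>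

lemma moment_exchange:
  fixes j :: "'m::finite"
  assumes k: "even k"
  defines "X \<equiv> \<lambda>v::(real^'n)^'m option. centered_sum (\<chi> j. v $ Some j)"
  shows "feature_mean (\<lambda>v. trace ((outer (v $ Some j) - K) ** mpow (X v) (Suc k))) \<le>
    Suc k * (real CARD('n) * feature_mean (\<lambda>v. trace ((outer (v $ Some j) + K) ** mpow (X v) k)))"
proof -
  let ?H = "\<lambda>v::(real^'n)^'m option. outer (v $ Some j)" and ?G = "\<lambda>v::(real^'n)^'m option. outer (v $ None)"
  define t where "t = Transposition.transpose None (Some j)"
  define s where "s = (\<lambda>v::(real^'n)^'m option. \<chi> i. v $ t i)"
  have t: "t None = Some j" "t (Some j) = None" "\<And>i. i \<noteq> j \<Longrightarrow> t (Some i) = Some i"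
    by (simp_all add: t_def)
  have "inj t" unfolding t_def by (simp add: bij_is_inj)
  have contX [continuous_intros]: "continuous_on S (\<lambda>v. X v)" for S
    unfolding X_def by (intro continuous_intros)
  have conts [continuous_intros]: "continuous_on S s" for S
    unfolding s_def by (intro continuous_intros)
  have contXs [continuous_intros]: "continuous_on S (\<lambda>v. X (s v))" for S
    by (intro continuous_on_compose2[OF contX conts]) auto
  have swap: "feature_mean (\<lambda>v. g (s v)) = feature_mean g" if "continuous_on UNIV g" for g
    unfolding s_def by (rule feature_mean_reindex[OF \<open>inj t\<close> that])
  have Hs: "?H (s v) = ?G v" "?G (s v) = ?H v" for v
    using t by (simp_all add: s_def)
  have Xs: "X (s v) = X v - ?H v + ?G v" for v
  proof -
    have *: "X w = ?H w - K + (\<Sum>i\<in>UNIV-{j}. outer (w $ Some i) - K)" for w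
      unfolding X_def centered_sum_def by (simp add: sum.remove[of UNIV j])
    have "s v $ Some i = v $ Some i" if "i \<noteq> j" for i
      using t(3)[OF that] by (simp add: s_def)
    then have "(\<Sum>i\<in>UNIV-{j}. outer (s v $ Some i) - K) = (\<Sum>i\<in>UNIV-{j}. outer (v $ Some i) - K)"
      by (intro sum.cong) auto
    then show ?thesis by (simp add: *[of v] *[of "s v"] Hs)
  qed
  have symX: "transpose (X v) = X v" for v
    unfolding X_def by (rule transpose_centered_sum)
  have ghost: "feature_mean (\<lambda>v. trace (?G v ** mpow (X v) i)) = feature_mean (\<lambda>v. trace (K ** mpow (X v) i))" for i
    unfolding X_def by (intro feature_mean_ghost_outer continuous_intros)
  let ?L = "feature_mean (\<lambda>v. trace ((?H v - ?G v) ** mpow (X v) (Suc k)))"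
  let ?R = "feature_mean (\<lambda>v. trace (((?H v - ?G v) ** (?H v - ?G v)) ** mpow (X v) k))"
  \<comment> \<open>The mean \<open>K\<close> is traded for the ghost sample, which makes the first
    factor antisymmetric under the exchange.\<close>
  have 1: "feature_mean (\<lambda>v. trace ((?H v - K) ** mpow (X v) (Suc k))) = ?L"
    unfolding matrix_diff_rdistrib trace_sub
    by (subst (1 2) feature_mean_diff) (intro continuous_intros | simp only: ghost)+
  \<comment> \<open>The exchange flips the sign of \<open>?H v - ?G v\<close>, so adding both forms
    of \<open>?L\<close> produces a difference of powers.\<close>
  have "?L = feature_mean (\<lambda>v. trace ((?H (s v) - ?G (s v)) ** mpow (X (s v)) (Suc k)))"
    by (rule swap[symmetric]) (intro continuous_intros)
  also have "\<dots> = feature_mean (\<lambda>v. (-1) * trace ((?H v - ?G v) ** mpow (X (s v)) (Suc k)))"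
    unfolding Hs by (simp only: matrix_diff_rdistrib trace_sub mult_minus1 minus_diff_eq)
  also have "\<dots> = - feature_mean (\<lambda>v. trace ((?H v - ?G v) ** mpow (X (s v)) (Suc k)))"
    unfolding feature_mean_cmult by (rule mult_minus1)
  finally have "2 * ?L = ?L - feature_mean (\<lambda>v. trace ((?H v - ?G v) ** mpow (X (s v)) (Suc k)))" by simp
  also have "\<dots> = feature_mean (\<lambda>v. trace ((?H v - ?G v) ** (mpow (X v) (Suc k) - mpow (X (s v)) (Suc k))))"
    unfolding matrix_diff_ldistrib trace_sub
    by (subst feature_mean_diff[symmetric]) (intro continuous_intros | simp only: )+
  finally have "4 * ?L = feature_mean (\<lambda>v. 2 * trace ((?H v - ?G v) ** (mpow (X v) (Suc k) - mpow (X (s v)) (Suc k))))"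
    unfolding feature_mean_cmult by simp
  also have "\<dots> \<le> feature_mean (\<lambda>v. Suc k * trace (((?H v - ?G v) ** (?H v - ?G v)) ** (mpow (X v) k + mpow (X (s v)) k)))"
  proof (rule feature_mean_mono)
    fix v
    have "X v - X (s v) = ?H v - ?G v" by (simp add: Xs)
    then show "2 * trace ((?H v - ?G v) ** (mpow (X v) (Suc k) - mpow (X (s v)) (Suc k))) \<le>
      Suc k * trace (((?H v - ?G v) ** (?H v - ?G v)) ** (mpow (X v) k + mpow (X (s v)) k))"
      using trace_mean_value_inequality[OF symX symX k, of v "s v"] by (simp only:)
  qed (intro continuous_intros)+
  also have "\<dots> = Suc k * (?R + feature_mean (\<lambda>v. trace (((?H v - ?G v) ** (?H v - ?G v)) ** mpow (X (s v)) k)))"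
    unfolding feature_mean_cmult matrix_add_ldistrib trace_add
    by (subst feature_mean_add) (intro continuous_intros | simp only:)+
  \<comment> \<open>The squared difference is invariant under the exchange, so the powers of
    \<open>X (s v)\<close> and of \<open>X v\<close> contribute equally.\<close>
  also have "feature_mean (\<lambda>v. trace (((?H v - ?G v) ** (?H v - ?G v)) ** mpow (X (s v)) k)) = ?R"
  proof -
    have eq: "(?H (s v) - ?G (s v)) ** (?H (s v) - ?G (s v)) = (?H v - ?G v) ** (?H v - ?G v)" for v
      unfolding Hs by (simp add: matrix_diff_ldistrib matrix_diff_rdistrib algebra_simps)
    have "feature_mean (\<lambda>v. trace (((?H (s v) - ?G (s v)) ** (?H (s v) - ?G (s v))) ** mpow (X (s v)) k)) = ?R"
      by (rule swap) (intro continuous_intros)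
    then show ?thesis by (simp only: eq)
  qed
  finally have 2: "2 * ?L \<le> Suc k * ?R" by (simp add: algebra_simps)
  \<comment> \<open>The square is replaced by a bound linear in the outer products; then the ghost
    sample is averaged back to \<open>K\<close>.\<close>
  have "?R \<le> feature_mean (\<lambda>v. trace (((2 * real CARD('n)) *\<^sub>R (?H v + ?G v)) ** mpow (X v) k))"
    by (intro feature_mean_mono continuous_intros trace_mult_mpow_mono symX k dot_diff_square_le)
  also have "\<dots> = feature_mean (\<lambda>v. (2 * real CARD('n)) * trace ((?H v + ?G v) ** mpow (X v) k))"
    by (simp add: scaleR_matrix_mult_left trace_scaleR)
  also have "\<dots> = (2 * real CARD('n)) * feature_mean (\<lambda>v. trace ((?H v + K) ** mpow (X v) k))"
    unfolding feature_mean_cmult matrix_add_rdistrib trace_add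
    by (subst (1 2) feature_mean_add) (intro continuous_intros | simp only: ghost)+
  finally have "Suc k * ?R \<le> Suc k * (2 * real CARD('n) * feature_mean (\<lambda>v. trace ((?H v + K) ** mpow (X v) k)))"
    by (intro mult_left_mono) auto
  with 2 have "2 * ?L \<le> Suc k * (2 * real CARD('n) * feature_mean (\<lambda>v. trace ((?H v + K) ** mpow (X v) k)))"
    by (rule order_trans)
  then show ?thesis unfolding 1 by (simp only: mult.assoc mult.left_commute[of _ 2])
qed

text \<open>The index type is \<open>'m option\<close>, although the ghost coordinate does not
  enter, to match the exchange argument. The \<open>itself\<close> argument fixes the sample size,
  which no other argument reveals.\<close>

definition moment :: "'m::finite itself \<Rightarrow> nat \<Rightarrow> real" where
  "moment _ k = feature_mean (\<lambda>v::(real^'n)^'m option. trace (mpow (centered_sum (\<chi> j. v $ Some j)) k))"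

text \<open>One factor of the power is expanded over the samples and the exchange bound is applied
  to each summand; the matrices \<open>?H v j + K\<close> add up to \<open>X v\<close> plus a
  multiple of \<open>K\<close>.\<close>

lemma moment_recursion:
  assumes k: "even k"
  shows "moment TYPE('m::finite) (Suc (Suc k)) \<le> Suc k * (real CARD('n) *
    feature_mean (\<lambda>v::(real^'n)^'m option. let X = centered_sum (\<chi> j. v $ Some j) in
      trace (mpow X (Suc k)) + 2 * real CARD('m) * trace (K ** mpow X k)))"
proof -
  define X where "X = (\<lambda>v::(real^'n)^'m option. centered_sum (\<chi> j. v $ Some j))"
  let ?H = "\<lambda>v::(real^'n)^'m option. \<lambda>j. outer (v $ Some j)"
  have contX [continuous_intros]: "continuous_on S (\<lambda>v. X v)" for S
    unfolding X_def by (intro continuous_intros)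
  have X: "X v = (\<Sum>j\<in>UNIV. ?H v j - K)" for v
    by (simp add: X_def centered_sum_def)
  have "moment TYPE('m) (Suc (Suc k)) = feature_mean (\<lambda>v. \<Sum>j\<in>UNIV. trace ((?H v j - K) ** mpow (X v) (Suc k)))"
    unfolding moment_def trace_sum[symmetric] matrix_mult_sum_left[symmetric] X[symmetric]
    by (simp add: X_def)
  also have "\<dots> = (\<Sum>j\<in>UNIV. feature_mean (\<lambda>v. trace ((?H v j - K) ** mpow (X v) (Suc k))))"
    by (intro feature_mean_sum continuous_intros)
  also have "\<dots> \<le> (\<Sum>j\<in>UNIV. Suc k * (real CARD('n) * feature_mean (\<lambda>v. trace ((?H v j + K) ** mpow (X v) k))))"
    unfolding X_def by (intro sum_mono moment_exchange k)
  also have "\<dots> = Suc k * (real CARD('n) * feature_mean (\<lambda>v. \<Sum>j\<in>UNIV. trace ((?H v j + K) ** mpow (X v) k)))"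
    unfolding sum_distrib_left[symmetric]
    by (subst feature_mean_sum) (intro continuous_intros | simp only:)+
  also have "(\<lambda>v. \<Sum>j\<in>UNIV. trace ((?H v j + K) ** mpow (X v) k)) =
    (\<lambda>v. trace (mpow (X v) (Suc k)) + 2 * real CARD('m) * trace (K ** mpow (X v) k))"
  proof
    fix v
    have "(\<Sum>j\<in>UNIV. ?H v j + K) = X v + (2 * real CARD('m)) *\<^sub>R K"
    proof -
      have "(\<Sum>j\<in>UNIV. ?H v j + K) = (\<Sum>j\<in>UNIV. (?H v j - K) + 2 *\<^sub>R K)"
        by (simp add: scaleR_2 add.commute)
      also have "\<dots> = X v + (\<Sum>j\<in>(UNIV::'m set). 2 *\<^sub>R K)"
        by (simp only: sum.distrib X)
      finally show ?thesis by (simp only: sum_constant_scaleR scaleR_scaleR mult.commute)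
    qed
    then show "(\<Sum>j\<in>UNIV. trace ((?H v j + K) ** mpow (X v) k)) =
       trace (mpow (X v) (Suc k)) + 2 * real CARD('m) * trace (K ** mpow (X v) k)"
      unfolding trace_sum[symmetric] matrix_mult_sum_left[symmetric]
      by (simp add: matrix_add_rdistrib trace_add scaleR_matrix_mult_left trace_scaleR)
  qed
  finally show ?thesis by (simp add: X_def Let_def)
qed

text \<open>Exchanging sample \<open>j\<close> with the ghost shows that its outer product has mean
  trace \<open>trace K\<close>, so the centering cancels it.\<close>

lemma moment_one: "moment TYPE('m::finite) 1 = 0"
proof -
  have feature_mean_ghost: "feature_mean (\<lambda>v::(real^'n)^'m option. trace (outer (v $ None))) = feature_mean (\<lambda>v::(real^'n)^'m option. trace K)"
    using feature_mean_ghost_outer[of "\<lambda>_. mat 1"] by (simp add: continuous_intros)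
  have "feature_mean (\<lambda>v::(real^'n)^'m option. trace (outer (v $ Some j))) = feature_mean (\<lambda>v::(real^'n)^'m option. trace K)" for j
  proof -
    define t where "t = Transposition.transpose None (Some j)"
    have "inj t" unfolding t_def by (simp add: bij_is_inj)
    from feature_mean_reindex[OF this, of "\<lambda>v. trace (outer (v $ None))"] show ?thesis
      by (simp add: t_def continuous_intros feature_mean_ghost)
  qed
  then show ?thesis
    unfolding moment_def centered_sum_def
    by (simp add: trace_sum trace_sub feature_mean_sum feature_mean_diff continuous_intros)
qed

lemma feature_mean_const: "feature_mean (\<lambda>_. c) = c"
proof -
  interpret P: prob_space "\<Pi>\<^sub>M i\<in>I. Q" for I :: "'i set" by (rule prob_space_product)
  show ?thesis by (simp add: feature_mean_def P.prob_space)
qed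

text \<open>The recursion at \<open>k = 0\<close>: the odd moment vanishes and only
  \<open>trace K\<close> remains, the source of the prefactor \<open>trace K / N\<close>
  below.\<close>

lemma moment_two: "moment TYPE('m::finite) 2 \<le> 2 * real CARD('n) * real CARD('m) * trace K"
proof -
  have "feature_mean (\<lambda>v::(real^'n)^'m option. let X = centered_sum (\<chi> j. v $ Some j) in
      trace (mpow X (Suc 0)) + 2 * real CARD('m) * trace (K ** mpow X 0)) =
    moment TYPE('m) 1 + 2 * real CARD('m) * trace K"
    unfolding Let_def moment_def
    by (subst feature_mean_add) (auto intro!: continuous_intros simp: feature_mean_const)
  then show ?thesis using moment_recursion[of 0, where ?'m = 'm]
    by (simp add: moment_one[simplified] numeral_2_eq_2 mult_ac)
qed

text \<open>The recursion is doubled, so that after the odd moment has been traded for even ones a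
  copy of the moment of order \<open>k + 2\<close> can be subtracted from both sides. The term with
  \<open>K\<close> is bounded through \<open>N\<close>.\<close>

lemma moment_step:
  assumes N: "\<And>u. u \<bullet> (K *v u) \<le> N * (norm u)\<^sup>2" and k: "even k"
    and c: "c = real (Suc k) * real CARD('n)"
  shows "moment TYPE('m::finite) (Suc (Suc k)) \<le> (4 * c * real CARD('m) * N + c\<^sup>2) * moment TYPE('m) k"
proof -
  let ?m = "real CARD('m)"
  let ?X = "\<lambda>v::(real^'n)^'m option. centered_sum (\<chi> j. v $ Some j)"
  have c0: "0 \<le> c" by (simp add: c)
  have "2 * moment TYPE('m) (Suc (Suc k)) \<le> feature_mean (\<lambda>v. 2 * c * (trace (mpow (?X v) (Suc k)) + 2 * ?m * trace (K ** mpow (?X v) k)))"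
    using moment_recursion[OF k, where ?'m = 'm] by (simp add: feature_mean_cmult c Let_def)
  also have "\<dots> \<le> feature_mean (\<lambda>v. trace (mpow (?X v) (Suc (Suc k))) + (4 * c * ?m * N + c\<^sup>2) * trace (mpow (?X v) k))"
  proof (rule feature_mean_mono)
    fix v
    have "trace (K ** mpow (?X v) k) \<le> trace ((N *\<^sub>R mat 1) ** mpow (?X v) k)"
      by (intro trace_mult_mpow_mono transpose_centered_sum k)
        (use N in \<open>simp add: scaleR_matrix_vector_assoc[symmetric] power2_norm_eq_inner\<close>)
    then have "4 * c * ?m * trace (K ** mpow (?X v) k) \<le> 4 * c * ?m * (N * trace (mpow (?X v) k))"
      using c0 by (intro mult_left_mono) (simp_all add: scaleR_matrix_mult_left trace_scaleR)
    then show "2 * c * (trace (mpow (?X v) (Suc k)) + 2 * ?m * trace (K ** mpow (?X v) k)) \<le>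
        trace (mpow (?X v) (Suc (Suc k))) + (4 * c * ?m * N + c\<^sup>2) * trace (mpow (?X v) k)"
      using trace_mpow_odd_le[OF transpose_centered_sum k, of c "\<chi> j. v $ Some j"]
      by (simp add: algebra_simps)
  qed (intro continuous_intros)+
  also have "\<dots> = moment TYPE('m) (Suc (Suc k)) + (4 * c * ?m * N + c\<^sup>2) * moment TYPE('m) k"
    unfolding moment_def feature_mean_cmult[symmetric] by (intro feature_mean_add continuous_intros)
  finally show ?thesis by simp
qed

lemma moment_nonneg: "even k \<Longrightarrow> 0 \<le> moment TYPE('m::finite) k"
proof -
  assume k: "even k"
  have "feature_mean (\<lambda>_::(real^'n)^'m option. 0) \<le> moment TYPE('m) k"
    unfolding moment_def
  proof (intro feature_mean_mono continuous_intros)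
    fix v :: "(real^'n)^'m option"
    let ?X = "centered_sum (\<chi> j. v $ Some j)"
    have "trace ((0::real^'n^'n) ** mpow ?X k) \<le> trace (mat 1 ** mpow ?X k)"
      by (intro trace_mult_mpow_mono transpose_centered_sum k) simp
    then show "0 \<le> trace (mpow ?X k)" by (simp add: trace_def)
  qed
  then show ?thesis by (simp add: feature_mean_const)
qed

text \<open>The step is iterated from the second moment. Its coefficient grows with the order, and
  \<open>c\<close> bounds it for all orders that occur.\<close>

lemma moment_bound:
  assumes N: "\<And>u. u \<bullet> (K *v u) \<le> N * (norm u)\<^sup>2" and N0: "0 < N" and T: "0 \<le> trace K"
    and c: "c = 2 * real p * real CARD('n)" and p: "1 \<le> p"
  shows "moment TYPE('m::finite) (2 * p) \<le> trace K / N * (4 * c * real CARD('m) * N + c\<^sup>2) ^ p"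
proof -
  let ?f = "4 * c * real CARD('m) * N + c\<^sup>2"
  have c0: "0 \<le> c" by (simp add: c)
  have "moment TYPE('m) (2 * q) \<le> trace K / N * ?f ^ q" if "1 \<le> q" "q \<le> p" for q
    using that
  proof (induction q rule: nat_induct_at_least)
    case base
    have "2 * real CARD('n) \<le> c" using p by (simp add: c)
    then have "2 * real CARD('n) * (real CARD('m) * trace K) \<le> c * (real CARD('m) * trace K)"
      by (intro mult_right_mono) (use T in auto)
    also have "\<dots> = trace K / N * (c * real CARD('m) * N)" using N0 by simp
    also have "\<dots> \<le> trace K / N * ?f"
      using c0 N0 T by (intro mult_left_mono) (auto intro!: divide_nonneg_pos)
    finally show ?case using moment_two[where ?'m = 'm] by (simp add: mult.assoc)
  next
    case (Suc q)
    \<comment> \<open>The step from order \<open>2 * q\<close> carries the factor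
      \<open>2 * q + 1\<close>, which is still at most \<open>2 * p\<close> because
      \<open>q < p\<close>.\<close>
    define d where "d = real (Suc (2 * q)) * real CARD('n)"
    have d: "0 \<le> d" "d \<le> c" unfolding d_def c using Suc.prems
      by (auto intro!: mult_right_mono)
    have "moment TYPE('m) (2 * Suc q) \<le> (4 * d * real CARD('m) * N + d\<^sup>2) * moment TYPE('m) (2 * q)"
      using moment_step[OF N, of "2 * q" d, where ?'m = 'm] by (simp add: d_def)
    also have "\<dots> \<le> ?f * moment TYPE('m) (2 * q)"
      using d N0 by (intro mult_right_mono moment_nonneg add_mono power_mono) auto
    also have "\<dots> \<le> ?f * (trace K / N * ?f ^ q)"
      using Suc c0 N0 by (intro mult_left_mono) auto
    finally show ?case by (simp add: mult_ac)
  qed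
  then show ?thesis using p by simp
qed

end

section \<open>Concentration of the empirical kernel matrix\<close>

text \<open>Pure arithmetic: \<open>\<theta>\<close> solves the sample size equation exactly, and a
  gain of \<open>exp (-1)\<close> in each of \<open>p\<close> factors makes up for both
  \<open>trace K / N\<close> and \<open>\<delta>\<close>.\<close>

lemma (in random_features) tail_bound_sample_size:
  fixes p :: nat
  assumes N0: "0 < N" and NT: "N \<le> trace K" and \<delta>: "0 < \<delta>" "\<delta> \<le> \<delta>\<^sub>0" "\<delta>\<^sub>0 < 1" and r: "1 \<le> r"
    and m: "0 < m" and n: "1 \<le> n" and \<theta>: "0 < \<theta>" "\<theta> \<le> r * N"
    and \<theta>_eq: "m * \<theta>\<^sup>2 = 100 * r * (1 + 1 / ln (1 / \<delta>\<^sub>0)) * (n * N * ln (trace K / (N * \<delta>)))"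
    and p: "p = nat \<lceil>ln (trace K / (N * \<delta>))\<rceil>" and c: "c = 2 * real p * n"
  shows "1 \<le> p" "trace K / N * (4 * c * m * N + c\<^sup>2) ^ p / (m * \<theta>) ^ (2 * p) \<le> \<delta>"
proof -
  define T where "T = trace K"
  define \<Lambda> where "\<Lambda> = ln (T / (N * \<delta>))"
  define l0 where "l0 = ln (1 / \<delta>\<^sub>0)"
  have T0: "0 < T" using N0 NT by (simp add: T_def)
  have \<delta>0: "0 < \<delta>\<^sub>0" using \<delta> by simp
  have l0: "0 < l0" unfolding l0_def using \<delta> \<delta>0 by (intro ln_gt_zero) simp
  have "1 / \<delta>\<^sub>0 \<le> T / (N * \<delta>)"
  proof -
    have "1 / \<delta>\<^sub>0 \<le> 1 / \<delta>" using \<delta> by (intro divide_left_mono) auto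
    also have "\<dots> \<le> (T / N) * (1 / \<delta>)"
      using \<delta> N0 NT mult_right_mono[of 1 "T / N" "1 / \<delta>"] by (simp add: T_def)
    finally show ?thesis by simp
  qed
  then have \<Lambda>: "l0 \<le> \<Lambda>" unfolding l0_def \<Lambda>_def using \<delta> \<delta>0 N0 T0 by (intro ln_mono) auto
  with l0 have \<Lambda>0: "0 < \<Lambda>" by simp
  have p\<Lambda>: "\<Lambda> \<le> real p" "real p \<le> \<Lambda> + 1"
    using \<Lambda>0 unfolding p \<Lambda>_def T_def by linarith+
  then show "1 \<le> p" using \<Lambda>0 by (cases p) auto
  \<comment> \<open>Rounding up adds at most 1, which \<open>1 \<le> \<Lambda> / l0\<close> turns
    into a constant factor. This is where \<open>\<delta>\<^sub>0\<close> enters the sample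
    size.\<close>
  have "real p \<le> \<Lambda> * (1 + 1 / l0)"
  proof -
    have "1 \<le> \<Lambda> / l0" using \<Lambda> l0 by simp
    then show ?thesis using p\<Lambda> by (simp add: algebra_simps)
  qed
  then have "2 * real p * n \<le> 2 * (\<Lambda> * (1 + 1 / l0)) * n"
    using n by (intro mult_right_mono mult_left_mono) auto
  then have "c * (50 * r * N) \<le> 2 * (\<Lambda> * (1 + 1 / l0)) * n * (50 * r * N)"
    using c r N0 by (intro mult_right_mono) auto
  also have "\<dots> = m * \<theta>\<^sup>2"
    unfolding \<theta>_eq l0_def \<Lambda>_def T_def by simp
  \<comment> \<open>This bound has two uses: \<open>1 \<le> r\<close> gives the version with
    \<open>N\<close>, and \<open>\<theta> \<le> r * N\<close> the version with
    \<open>\<theta>\<close>.\<close>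
  finally have cA: "50 * (c * (r * N)) \<le> m * \<theta>\<^sup>2" by simp
  have c0: "0 \<le> c" using c n by simp
  have "c * N \<le> c * (r * N)" using c0 N0 r by (intro mult_left_mono) auto
  with cA have cN: "50 * (c * N) \<le> m * \<theta>\<^sup>2" by simp
  have "c * \<theta> \<le> c * (r * N)" using c0 \<theta> by (intro mult_left_mono) auto
  with cA have "(50 * c) * \<theta> \<le> (m * \<theta>) * \<theta>" by (simp add: power2_eq_square)
  then have c50: "50 * c \<le> m * \<theta>" using \<theta> by simp
  define a where "a = m * \<theta>"
  have a0: "0 < a" using m \<theta> by (simp add: a_def)
  have "(50 * c)\<^sup>2 \<le> a\<^sup>2" using c50 c0 unfolding a_def by (intro power_mono) auto
  then have f2: "2500 * c\<^sup>2 \<le> a\<^sup>2" by (simp add: power_mult_distrib)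
  have f1: "50 * (c * N * m) \<le> a\<^sup>2"
    using mult_left_mono[OF cN, of m] m by (simp add: a_def power_mult_distrib power2_eq_square mult_ac)
  define f where "f = 4 * c * m * N + c\<^sup>2"
  have f0: "0 \<le> f" using c0 m N0 by (simp add: f_def)
  \<comment> \<open>The two summands are at most 4/50 and 1/2500 of \<open>a\<^sup>2\<close>,
    together less than a third, and \<open>exp 1 \<le> 3\<close>.\<close>
  have "f = 4 * (c * N * m) + c\<^sup>2" by (simp add: f_def)
  then have "f * 3 \<le> a\<^sup>2" using f1 f2 zero_le_power2[of a] by linarith
  moreover have "f * exp 1 \<le> f * 3" using f0 exp_le by (intro mult_left_mono) auto
  ultimately have "f * exp 1 \<le> a\<^sup>2" by simp
  then have "f \<le> a\<^sup>2 * exp (-1)" by (simp add: exp_minus field_simps)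
  then have "f ^ p \<le> (a\<^sup>2 * exp (-1)) ^ p" using f0 by (intro power_mono)
  also have "\<dots> = a ^ (2 * p) * exp (- real p)"
    by (simp add: power_mult_distrib power_mult exp_of_nat_mult[symmetric])
  also have "\<dots> \<le> a ^ (2 * p) * exp (- \<Lambda>)" using p\<Lambda> a0 by (intro mult_left_mono) auto
  also have "exp (- \<Lambda>) = N * \<delta> / T"
    using T0 N0 \<delta> by (simp add: \<Lambda>_def exp_minus)
  finally have "f ^ p / a ^ (2 * p) \<le> N * \<delta> / T" using a0 by (simp add: pos_divide_le_eq mult.commute)
  then have "T / N * (f ^ p / a ^ (2 * p)) \<le> T / N * (N * \<delta> / T)"
    using T0 N0 by (intro mult_left_mono) auto
  then show "trace K / N * (4 * c * m * N + c\<^sup>2) ^ p / (m * \<theta>) ^ (2 * p) \<le> \<delta>"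
    using T0 N0 by (simp add: f_def a_def T_def)
qed

text \<open>In this form \<open>K\<close> is visibly positive semidefinite, which the comparison of
  its norm with its trace uses.\<close>

lemma (in random_features) dot_K:
  "u \<bullet> (K *v u) = (\<integral>\<omega>. (z \<omega> \<bullet> u)\<^sup>2 \<partial>Q)"
proof -
  have int: "integrable Q (\<lambda>\<omega>. (z \<omega> $ i * z \<omega> $ j) * c)" for i j c
  proof (rule integrable_const_bound)
    show "AE \<omega> in Q. norm ((z \<omega> $ i * z \<omega> $ j) * c) \<le> \<bar>c\<bar>"
      using z_bound by (intro AE_I2) (simp add: abs_mult mult_le_one mult_left_le_one_le)
    have [measurable]: "(\<lambda>\<omega>. z \<omega> $ i) \<in> borel_measurable Q" for i
      by (rule measurable_compose[OF z_measurable]) simp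
    show "(\<lambda>\<omega>. (z \<omega> $ i * z \<omega> $ j) * c) \<in> borel_measurable Q" by measurable
  qed
  have "(z \<omega> \<bullet> u)\<^sup>2 = (\<Sum>i\<in>UNIV. \<Sum>j\<in>UNIV. (z \<omega> $ i * z \<omega> $ j) * (u $ i * u $ j))" for \<omega>
    by (simp add: power2_eq_square inner_vec_def sum_product mult_ac)
  then have "(\<integral>\<omega>. (z \<omega> \<bullet> u)\<^sup>2 \<partial>Q) = (\<Sum>i\<in>UNIV. \<Sum>j\<in>UNIV. (\<integral>\<omega>. (z \<omega> $ i * z \<omega> $ j) * (u $ i * u $ j) \<partial>Q))"
    using int by (simp add: Bochner_Integration.integral_sum integrable_sum)
  also have "\<dots> = (\<Sum>i\<in>UNIV. \<Sum>j\<in>UNIV. K $ i $ j * (u $ i * u $ j))"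
    by (simp add: K_eq)
  also have "\<dots> = u \<bullet> (K *v u)"
    by (simp add: inner_vec_def matrix_vector_mult_def sum_distrib_left mult_ac)
  finally show ?thesis by simp
qed

lemma (in random_features) K_psd: "0 \<le> u \<bullet> (K *v u)"
  unfolding dot_K by simp

lemma abs_dot_mult_le_spectral_norm:
  fixes A :: "real^'n^'n"
  shows "\<bar>v \<bullet> (A *v v)\<bar> \<le> spectral_norm A * (norm v)\<^sup>2"
proof -
  have "\<bar>v \<bullet> (A *v v)\<bar> \<le> norm v * norm (A *v v)" by (rule Cauchy_Schwarz_ineq2)
  also have "\<dots> \<le> norm v * (spectral_norm A * norm v)"
    unfolding spectral_norm_def by (intro mult_left_mono onorm) auto
  finally show ?thesis by (simp add: power2_eq_square mult_ac)
qed

lemma spectral_norm_nonneg: "0 \<le> spectral_norm A"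
  unfolding spectral_norm_def by (intro onorm_pos_le) simp

lemma spectral_norm_eq_0: "spectral_norm A = 0 \<longleftrightarrow> A = 0"
  unfolding spectral_norm_def by (subst onorm_eq_0) (auto simp: matrix_eq)

text \<open>The joint law of independent samples with law \<open>Q\<close> is the product measure;
  the ghost coordinate is added so that the right-hand side matches the moments.\<close>

lemma (in random_features) expectation_features:
  fixes W :: "'m::finite \<Rightarrow> 's \<Rightarrow> 'w" and g :: "(real^'n)^'m \<Rightarrow> real"
  assumes M: "prob_space M" and indep: "prob_space.indep_vars M (\<lambda>_. Q) W UNIV"
    and dist: "\<And>j. distr M Q (W j) = Q" and g: "continuous_on UNIV g"
  shows "(\<integral>s. g (\<chi> j. z (W j s)) \<partial>M) = feature_mean (\<lambda>v::(real^'n)^'m option. g (\<chi> j. v $ Some j))"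
proof -
  interpret M: prob_space M by fact
  have W [measurable]: "W j \<in> M \<rightarrow>\<^sub>M Q" for j
    using indep unfolding M.indep_vars_def by simp
  have "distr M (\<Pi>\<^sub>M j\<in>UNIV. Q) (\<lambda>s. \<lambda>j\<in>UNIV. W j s) = (\<Pi>\<^sub>M j\<in>UNIV. distr M Q (W j))"
    using indep by (subst M.indep_vars_iff_distr_eq_PiM[symmetric]) auto
  then have P: "distr M (\<Pi>\<^sub>M j\<in>UNIV. Q) (\<lambda>s. \<lambda>j\<in>UNIV. W j s) = (\<Pi>\<^sub>M j\<in>UNIV. Q)"
    by (simp add: dist)
  have "feature_mean (\<lambda>v::(real^'n)^'m option. g (\<chi> j. v $ Some j)) = feature_mean g"
    by (intro feature_mean_reindex g) auto
  also have "\<dots> = (\<integral>\<omega>. g (\<chi> j. z (\<omega> j)) \<partial>distr M (\<Pi>\<^sub>M j\<in>UNIV. Q) (\<lambda>s. \<lambda>j\<in>UNIV. W j s))"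
    unfolding P by (simp add: feature_mean_def)
  also have "\<dots> = (\<integral>s. g (\<chi> j. z ((\<lambda>j\<in>UNIV. W j s) j)) \<partial>M)"
  proof (rule integral_distr)
    show "(\<lambda>s. \<lambda>j\<in>UNIV. W j s) \<in> M \<rightarrow>\<^sub>M (\<Pi>\<^sub>M j\<in>UNIV. Q)" by measurable
    show "(\<lambda>\<omega>. g (\<chi> j. z (\<omega> j))) \<in> borel_measurable (\<Pi>\<^sub>M j\<in>UNIV. Q)"
      using feature_mean_integrable[OF g] by auto
  qed
  finally show ?thesis by simp
qed

text \<open>The event is defined through the smallest \<open>\<tau>\<close> that satisfies the sample size bound for the given \<open>m\<close>.
  Hence \<open>\<tau>\<close> may depend on the sample.\<close>

lemma (in random_features) empirical_kernel_concentration: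
  fixes W :: "'m::finite \<Rightarrow> 's \<Rightarrow> 'w"
  assumes M: "prob_space M" and indep: "prob_space.indep_vars M (\<lambda>_. Q) W UNIV"
    and dist: "\<And>j. distr M Q (W j) = Q"
    and \<delta>: "0 < \<delta>" "\<delta> \<le> \<delta>\<^sub>0" "\<delta>\<^sub>0 < 1" and r: "1 \<le> r"
  shows "\<exists>S\<in>sets M. measure M S \<ge> 1 - \<delta> \<and> (\<forall>s\<in>S. \<forall>\<tau>. 0 < \<tau> \<and>
    (spectral_norm K \<noteq> 0 \<longrightarrow> \<tau> \<le> r * spectral_norm K) \<and>
    real CARD('m) \<ge> 100 * r * (1 + 1 / ln (1 / \<delta>\<^sub>0)) *
      (real CARD('n) * spectral_norm K / \<tau>\<^sup>2 * ln (trace K / (spectral_norm K * \<delta>))) \<longrightarrow>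
    spectral_norm (centered_sum (\<chi> j. z (W j s))) \<le> real CARD('m) * \<tau>)"
proof -
  interpret M: prob_space M by fact
  define N where "N = spectral_norm K"
  define X where "X = (\<lambda>s. centered_sum (\<chi> j. z (W j s)))"
  let ?m = "real CARD('m)" and ?n = "real CARD('n)"
  have m0: "0 < ?m" by simp
  have W [measurable]: "W j \<in> M \<rightarrow>\<^sub>M Q" for j
    using indep unfolding M.indep_vars_def by simp
  have X: "centered_sum (\<chi> j. z (W j s)) = X s" for s by (simp add: X_def)
  have symX: "transpose (X s) = X s" for s
    unfolding X_def by (rule transpose_centered_sum)
  have cont: "continuous_on UNIV (\<lambda>u::(real^'n)^'m. trace (mpow (centered_sum u) k))" for k
    by (intro continuous_intros)
  have int: "integrable M (\<lambda>s. trace (mpow (X s) k))" for k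
    unfolding X_def
    by (rule integrable_continuous_features[OF cont, where V = "\<lambda>j s. z (W j s)"])
      (auto intro: M z_bound)
  then have [measurable]: "(\<lambda>s. trace (mpow (X s) k)) \<in> borel_measurable M" for k by auto
  have mom: "(\<integral>s. trace (mpow (X s) k) \<partial>M) = moment TYPE('m) k" for k
    unfolding X_def moment_def by (rule expectation_features[OF M indep dist cont])
  have nonneg: "0 \<le> trace (mpow (X s) (2 * k))" for s k
  proof -
    have "trace ((0::real^'n^'n) ** mpow (X s) (2 * k)) \<le> trace (mat 1 ** mpow (X s) (2 * k))"
      by (intro trace_mult_mpow_mono symX) auto
    then show ?thesis by (simp add: trace_def)
  qed
  have NT: "N \<le> trace K" unfolding N_def by (intro spectral_norm_le_trace transpose_K K_psd)
  have N_le: "u \<bullet> (K *v u) \<le> N * (norm u)\<^sup>2" for u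
    unfolding N_def using abs_dot_mult_le_spectral_norm[of u K] by linarith
  consider "N = 0" | "0 < N" using spectral_norm_nonneg[of K] unfolding N_def by linarith
  then show ?thesis
  proof cases
    \<comment> \<open>Here the sample size condition reads \<open>0 \<le> m\<close>, so every
      positive \<open>\<tau>\<close> must be served. The second moment vanishes, hence the centered
      sum is zero almost surely.\<close>
    case 1
    then have "K = 0" by (simp add: N_def spectral_norm_eq_0)
    then have "moment TYPE('m) 2 \<le> 0"
      using moment_two[where ?'m = 'm] by (simp add: trace_def)
    then have "(\<integral>s. trace (mpow (X s) (2 * 1)) \<partial>M) = 0"
      unfolding mom using moment_nonneg[of 2, where ?'m = 'm] by simp
    then have AE: "AE s in M. trace (mpow (X s) (2 * 1)) = 0"
      by (subst (asm) integral_nonneg_eq_0_iff_AE[OF int]) (use nonneg[of _ 1] in auto)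
    let ?S = "{s\<in>space M. trace (mpow (X s) (2 * 1)) = 0}"
    have S: "?S \<in> sets M" by measurable
    moreover have "measure M ?S = 1"
      using AE S by (subst M.prob_eq_1) auto
    moreover have "spectral_norm (X s) \<le> ?m * \<tau>" if "s \<in> ?S" "0 < \<tau>" for s \<tau>
      using that spectral_norm_le_if_trace_mpow_le[OF symX[of s], of 1 0] by simp
        (meson m0 mult_nonneg_nonneg less_eq_real_def order_trans)
    ultimately show ?thesis using \<delta> unfolding X by (intro bexI[of _ ?S]) auto
  next
    case 2
    define \<Lambda> where "\<Lambda> = ln (trace K / (N * \<delta>))"
    define C where "C = 100 * r * (1 + 1 / ln (1 / \<delta>\<^sub>0)) * (?n * N * \<Lambda>)"
    define \<theta> where "\<theta> = sqrt (C / ?m)"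
    have \<delta>1: "\<delta> < 1" using \<delta> by simp
    have "1 < trace K / (N * \<delta>)"
    proof -
      have "N * \<delta> < N" using 2 \<delta>1 by simp
      then have "N * \<delta> < trace K" using NT by linarith
      then show ?thesis using 2 \<delta> by (simp add: less_divide_eq)
    qed
    then have \<Lambda>0: "0 < \<Lambda>" unfolding \<Lambda>_def by (rule ln_gt_zero)
    have "0 < ln (1 / \<delta>\<^sub>0)" using \<delta> by (intro ln_gt_zero) simp
    then have "0 < 1 + 1 / ln (1 / \<delta>\<^sub>0)" by (intro add_pos_pos) auto
    then have C0: "0 < C" unfolding C_def using r 2 \<Lambda>0 by (intro mult_pos_pos) auto
    have \<theta>0: "0 < \<theta>" unfolding \<theta>_def using C0 by simp
    have \<theta>2: "?m * \<theta>\<^sup>2 = C" unfolding \<theta>_def using C0 by simp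
    have \<theta>_le: "\<theta> \<le> \<tau>" if "0 < \<tau>" and "100 * r * (1 + 1 / ln (1 / \<delta>\<^sub>0)) *
      (?n * spectral_norm K / \<tau>\<^sup>2 * ln (trace K / (spectral_norm K * \<delta>))) \<le> ?m" for \<tau>
    proof -
      have "C / \<tau>\<^sup>2 \<le> ?m" using that(2) by (simp add: C_def N_def \<Lambda>_def)
      then have "C \<le> ?m * \<tau>\<^sup>2" using that(1) by (subst (asm) pos_divide_le_eq) auto
      then have "?m * \<theta>\<^sup>2 \<le> ?m * \<tau>\<^sup>2" unfolding \<theta>2 .
      then have "\<theta>\<^sup>2 \<le> \<tau>\<^sup>2" using m0 by simp
      then show ?thesis using that(1) by (rule power2_le_imp_le[OF _ less_imp_le])
    qed
    show ?thesis
    proof (cases "\<theta> \<le> r * N")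
      \<comment> \<open>If even \<open>\<theta>\<close> exceeds \<open>r * N\<close>, no
        \<open>\<tau>\<close> meets both conditions and the whole space serves.\<close>
      case False
      then have "\<not> (0 < \<tau> \<and> (spectral_norm K \<noteq> 0 \<longrightarrow> \<tau> \<le> r * spectral_norm K) \<and>
         ?m \<ge> 100 * r * (1 + 1 / ln (1 / \<delta>\<^sub>0)) *
          (?n * spectral_norm K / \<tau>\<^sup>2 * ln (trace K / (spectral_norm K * \<delta>))))" for \<tau>
        using \<theta>_le[of \<tau>] 2 unfolding N_def by force
      then show ?thesis
        using \<delta> by (intro bexI[of _ "space M"]) (auto simp: M.prob_space)
    next
      case True
      define p where "p = nat \<lceil>\<Lambda>\<rceil>"
      define c where "c = 2 * real p * ?n"
      have n1: "1 \<le> ?n" by (simp add: Suc_leI)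
      note tail = tail_bound_sample_size[OF 2 NT \<delta> r m0 n1 \<theta>0 True
          \<theta>2[unfolded C_def \<Lambda>_def] p_def[unfolded \<Lambda>_def] c_def]
      let ?a = "?m * \<theta>"
      let ?B = "{s\<in>space M. trace (mpow (X s) (2 * p)) \<ge> ?a ^ (2 * p)}"
      have a0: "0 < ?a" using m0 \<theta>0 by simp
      \<comment> \<open>Markov's inequality for the trace of an even power; off \<open>?B\<close>
        the trace controls the spectral norm.\<close>
      have "measure M ?B \<le> moment TYPE('m) (2 * p) / ?a ^ (2 * p)"
        unfolding mom[symmetric] using a0 nonneg
        by (intro integral_Markov_inequality_measure[where A = "space M"] int) auto
      also have "\<dots> \<le> trace K / N * (4 * c * ?m * N + c\<^sup>2) ^ p / ?a ^ (2 * p)"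
        using a0 NT 2 tail(1) by (intro divide_right_mono moment_bound N_le c_def) auto
      also have "\<dots> \<le> \<delta>" by (rule tail(2))
      finally have B: "measure M ?B \<le> \<delta>" .
      have Bs: "?B \<in> sets M" by measurable
      have "spectral_norm (X s) \<le> ?m * \<tau>"
        if s: "s \<in> space M - ?B" and \<tau>: "\<theta> \<le> \<tau>" for s \<tau>
      proof -
        have "spectral_norm (X s) \<le> ?a"
          using s a0 tail(1) by (intro spectral_norm_le_if_trace_mpow_le[OF symX[of s], of p]) auto
        also have "\<dots> \<le> ?m * \<tau>" using \<tau> by (intro mult_left_mono) auto
        finally show ?thesis .
      qed
      then show ?thesis using B Bs \<theta>_le M.prob_compl[OF Bs]
        unfolding X by (intro bexI[of _ "space M - ?B"]) auto
    qed
  qed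
qed

section \<open>Smooth and strongly convex functions\<close>

text \<open>The gradient is assembled from the derivatives along the basis vectors; uniqueness of
  the derivative justifies the definite description in \<open>grad\<close>.\<close>

lemma GDERIV_grad:
  fixes f :: "'a::euclidean_space \<Rightarrow> real"
  assumes "f differentiable (at w)"
  shows "GDERIV f w :> grad f w"
proof -
  obtain f' where f': "(f has_derivative f') (at w)"
    using assms by (auto simp: differentiable_def)
  interpret bounded_linear f' using f' by (rule has_derivative_bounded_linear)
  have "f' h = h \<bullet> (\<Sum>b\<in>Basis. f' b *\<^sub>R b)" for h
  proof -
    have "f' h = f' (\<Sum>b\<in>Basis. (h \<bullet> b) *\<^sub>R b)" by (simp add: euclidean_representation)
    also have "\<dots> = (\<Sum>b\<in>Basis. (h \<bullet> b) * f' b)" by (simp add: sum scaleR)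
    finally show ?thesis by (simp add: inner_sum_right mult.commute)
  qed
  then have g: "GDERIV f w :> (\<Sum>b\<in>Basis. f' b *\<^sub>R b)"
    unfolding gderiv_def using f' by (metis (no_types, lifting) ext)
  have "g1 = g2" if "GDERIV f w :> g1" "GDERIV f w :> g2" for g1 g2
  proof -
    have "(\<lambda>h. h \<bullet> g1) = (\<lambda>h. h \<bullet> g2)"
      using that unfolding gderiv_def by (rule has_derivative_unique)
    then show ?thesis by (metis vector_eq_ldot)
  qed
  then show ?thesis unfolding grad_def using g by (metis (mono_tags, lifting) theI)
qed

lemma DERIV_along_line:
  fixes f :: "'a::euclidean_space \<Rightarrow> real"
  assumes "\<And>w. f differentiable (at w)"
  shows "((\<lambda>t. f (w + t *\<^sub>R d)) has_real_derivative d \<bullet> grad f (w + t *\<^sub>R d)) (at t)"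
proof -
  have "((\<lambda>t. w + t *\<^sub>R d) has_derivative (\<lambda>h. h *\<^sub>R d)) (at t)"
    by (auto intro!: derivative_eq_intros)
  from has_derivative_compose[OF this GDERIV_grad[OF assms, unfolded gderiv_def]]
  show ?thesis by (simp add: has_field_derivative_def mult_commute_abs)
qed

text \<open>Descent lemma: along the segment, \<open>f\<close> minus its quadratic model has
  nonpositive derivative by Cauchy-Schwarz and the Lipschitz bound.\<close>

lemma smooth_upper_bound:
  fixes f :: "'a::euclidean_space \<Rightarrow> real"
  assumes "smooth L f"
  shows "f (w + d) \<le> f w + d \<bullet> grad f w + L / 2 * (norm d)\<^sup>2"
proof -
  have diff: "\<And>w. f differentiable (at w)" and lip: "L-lipschitz_on UNIV (grad f)"
    using assms by (auto simp: smooth_def)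
  let ?\<phi> = "\<lambda>t. f (w + t *\<^sub>R d) - (t * (d \<bullet> grad f w) + L / 2 * (norm d)\<^sup>2 * t\<^sup>2)"
  have "?\<phi> 1 \<le> ?\<phi> 0"
  proof (rule DERIV_nonpos_imp_nonincreasing[where f = ?\<phi>])
    fix t :: real assume t: "0 \<le> t" "t \<le> 1"
    let ?D = "d \<bullet> grad f (w + t *\<^sub>R d) - (d \<bullet> grad f w + L * (norm d)\<^sup>2 * t)"
    have "(?\<phi> has_real_derivative ?D) (at t)"
      by (auto intro!: derivative_eq_intros DERIV_along_line diff)
    moreover have "?D \<le> 0"
    proof -
      have "d \<bullet> (grad f (w + t *\<^sub>R d) - grad f w) \<le> norm d * norm (grad f (w + t *\<^sub>R d) - grad f w)"
        by (rule norm_cauchy_schwarz)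
      also have "\<dots> \<le> norm d * (L * norm ((w + t *\<^sub>R d) - w))"
        using lipschitz_onD[OF lip, of "w + t *\<^sub>R d" w] by (intro mult_left_mono) (auto simp: dist_norm)
      also have "\<dots> = L * (norm d)\<^sup>2 * t" using t by (simp add: power2_eq_square)
      finally show ?thesis by (simp add: inner_diff_right)
    qed
    ultimately show "\<exists>y. DERIV ?\<phi> t :> y \<and> y \<le> 0" by blast
  qed simp
  then show ?thesis by simp
qed

text \<open>Polyak-Lojasiewicz inequality: the tangent bound for the convex part along the line from
  \<open>w\<close> to \<open>v\<close>, followed by completing the square in
  \<open>d\<close>.\<close>

lemma strongly_convex_gap_le_grad:
  fixes f :: "'a::euclidean_space \<Rightarrow> real"
  assumes conv: "strongly_convex c f" and diff: "\<And>w. f differentiable (at w)" and c: "0 < c"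
  shows "2 * c * (f w - f v) \<le> (norm (grad f w))\<^sup>2"
proof -
  let ?q = "\<lambda>u. f u - c / 2 * (norm u)\<^sup>2"
  define d where "d = v - w"
  let ?g = "grad f w"
  let ?\<phi> = "\<lambda>t. ?q (w + t *\<^sub>R d)"
  have q: "convex_on UNIV ?q" using conv by (simp add: strongly_convex_def)
  have "convex_on UNIV ?\<phi>"
  proof (rule convex_onI)
    fix t x y :: real assume t: "0 < t" "t < 1"
    have "w + ((1 - t) *\<^sub>R x + t *\<^sub>R y) *\<^sub>R d = (1 - t) *\<^sub>R (w + x *\<^sub>R d) + t *\<^sub>R (w + y *\<^sub>R d)"
      by (simp add: algebra_simps)
    then show "?\<phi> ((1 - t) *\<^sub>R x + t *\<^sub>R y) \<le> (1 - t) * ?\<phi> x + t * ?\<phi> y"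
      using convex_onD[OF q, of t "w + x *\<^sub>R d" "w + y *\<^sub>R d"] t by simp
  qed simp
  moreover have sq: "(norm (w + t *\<^sub>R d))\<^sup>2 = (norm w)\<^sup>2 + 2 * t * (w \<bullet> d) + t\<^sup>2 * (norm d)\<^sup>2" for t
    unfolding power2_norm_eq_inner
    by (simp add: inner_add inner_commute power2_eq_square algebra_simps)
  have "(?\<phi> has_real_derivative d \<bullet> ?g - c * (w \<bullet> d)) (at 0)"
    unfolding sq by (rule derivative_eq_intros DERIV_along_line diff | simp)+
  ultimately have "?\<phi> 1 - ?\<phi> 0 \<ge> (d \<bullet> ?g - c * (w \<bullet> d)) * (1 - 0)"
    by (intro convex_on_imp_above_tangent[where A = UNIV]) auto
  moreover have "w + 1 *\<^sub>R d = v" by (simp add: d_def)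
  ultimately have "f w - f v \<le> - (d \<bullet> ?g) - c / 2 * (norm d)\<^sup>2"
    using sq[of 1] by (simp add: field_simps)
  then have "2 * c * (f w - f v) \<le> 2 * c * (- (d \<bullet> ?g) - c / 2 * (norm d)\<^sup>2)"
    using c by (intro mult_left_mono) auto
  also have "\<dots> = (norm ?g)\<^sup>2 - (norm (?g + c *\<^sub>R d))\<^sup>2"
    unfolding power2_norm_eq_inner
    by (simp add: inner_add inner_commute power2_eq_square algebra_simps)
  also have "\<dots> \<le> (norm ?g)\<^sup>2" by simp
  finally show ?thesis .
qed

section \<open>Approximate Newton steps\<close>

text \<open>The last bound says that the inverse of \<open>A\<close> is at least
  \<open>1 / b\<close> as a quadratic form. Testing \<open>A\<close> at
  \<open>u - (1 / b) *\<^sub>R g\<close> yields it without matrix square roots.\<close>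

lemma symmetric_definite_inverse_bounds:
  fixes A :: "real^'n^'n" and g :: "real^'n"
  assumes sym: "transpose A = A" and a: "0 < a"
    and lower: "\<And>v. a * (norm v)\<^sup>2 \<le> v \<bullet> (A *v v)" and upper: "\<And>v. v \<bullet> (A *v v) \<le> b * (norm v)\<^sup>2"
  defines "u \<equiv> matrix_inv A *v g"
  shows "A *v u = g" "a * (norm u)\<^sup>2 \<le> u \<bullet> g" "(norm g)\<^sup>2 \<le> b * (u \<bullet> g)"
proof -
  have "v = 0" if "A *v v = 0" for v
    using lower[of v] a that by (simp add: mult_le_0_iff)
  then have "inj ((*v) A)"
    by (subst linear_injective_0) auto
  then have "invertible A"
    using matrix_left_invertible_injective invertible_left_inverse by metis
  then have "A ** matrix_inv A = mat 1"
    unfolding invertible_def matrix_inv_def by (rule someI2_ex) blast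
  then show Au: "A *v u = g" unfolding u_def by (simp add: matrix_vector_mul_assoc)
  show "a * (norm u)\<^sup>2 \<le> u \<bullet> g" using lower[of u] Au by simp
  \<comment> \<open>Any unit vector will do for comparing the two bounds.\<close>
  have "a \<le> b" using lower[of "axis undefined 1"] upper[of "axis undefined 1"] by simp
  with a have b: "0 < b" by simp
  have "0 \<le> a * (norm (u - (1 / b) *\<^sub>R g))\<^sup>2" using a by simp
  also have "\<dots> \<le> (u - (1 / b) *\<^sub>R g) \<bullet> (A *v (u - (1 / b) *\<^sub>R g))" by (rule lower)
  also have "\<dots> = u \<bullet> g - 2 / b * (norm g)\<^sup>2 + 1 / b\<^sup>2 * (g \<bullet> (A *v g))"
    using symmetric_dot_commute[OF sym, of u g] unfolding power2_norm_eq_inner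
    by (simp add: matrix_vector_mult_diff_distrib matrix_vector_mult_scaleR Au inner_diff
        inner_commute power2_eq_square algebra_simps)
  also have "\<dots> \<le> u \<bullet> g - 2 / b * (norm g)\<^sup>2 + 1 / b\<^sup>2 * (b * (norm g)\<^sup>2)"
    using upper[of g] by (intro add_left_mono mult_left_mono) auto
  also have "\<dots> = u \<bullet> g - (norm g)\<^sup>2 / b"
    using b by (simp add: power2_eq_square field_simps)
  finally show "(norm g)\<^sup>2 \<le> b * (u \<bullet> g)" using b by (simp add: field_simps)
qed

section \<open>Perturbation of the Hessian and the resulting step\<close>

lemma spectral_norm_mult_le: "spectral_norm (A ** B) \<le> spectral_norm A * spectral_norm (B :: real^'n^'m)"
proof -
  have "(\<lambda>v. (A ** B) *v v) = (*v) A \<circ> (*v) B" by (auto simp: matrix_vector_mul_assoc)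
  then show ?thesis unfolding spectral_norm_def
    using onorm_compose[of "(*v) A" "(*v) B"] by simp
qed

lemma spectral_norm_add_le: "spectral_norm (A + B) \<le> spectral_norm A + spectral_norm (B :: real^'n^'m)"
  unfolding spectral_norm_def matrix_vector_mult_add_rdistrib by (rule onorm_triangle) auto

lemma spectral_norm_scaleR: "spectral_norm (c *\<^sub>R A) = \<bar>c\<bar> * spectral_norm (A :: real^'n^'m)"
  unfolding spectral_norm_def scaleR_matrix_vector_assoc[symmetric] by (rule onorm_scaleR) auto

lemma spectral_norm_mat_1_le: "spectral_norm (mat 1 :: real^'n^'n) \<le> 1"
  unfolding spectral_norm_def by (intro onorm_le) simp

text \<open>Up to the factor 1/n the quadratic parts differ by
  \<open>G' ** D ** (G' - G) + (G' - G) ** D ** G\<close>. For the two Gram matrices and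
  \<open>c = lam1\<close> the coefficient is \<open>\<zeta>\<close>.\<close>

lemma hessian_form_diff_le:
  fixes D G G' :: "real^'n^'n"
  assumes D: "spectral_norm D \<le> c" and lam: "0 \<le> lam"
  shows "spectral_norm (hessian_form lam D G' - hessian_form lam D G) \<le>
    (lam + c * spectral_norm ((1 / real CARD('n)) *\<^sub>R G') + c * spectral_norm ((1 / real CARD('n)) *\<^sub>R G))
      * spectral_norm (G' - G)"
proof -
  let ?n = "1 / real CARD('n)" and ?d = "spectral_norm (G' - G)"
  have c0: "0 \<le> c" using D spectral_norm_nonneg[of D] by simp
  have eq: "hessian_form lam D G' - hessian_form lam D G =
      ((?n *\<^sub>R G') ** (D ** (G' - G)) + (G' - G) ** (D ** (?n *\<^sub>R G))) + lam *\<^sub>R (G' - G)"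
    by (simp add: hessian_form_def matrix_diff_ldistrib matrix_diff_rdistrib scaleR_matrix_mult_left
        scaleR_matrix_mult_right matrix_mul_assoc scaleR_diff_right)
  have "spectral_norm ((?n *\<^sub>R G') ** (D ** (G' - G))) \<le> spectral_norm (?n *\<^sub>R G') * (c * ?d)"
    by (intro order_trans[OF spectral_norm_mult_le] mult_left_mono mult_right_mono D spectral_norm_nonneg)
  moreover have "spectral_norm ((G' - G) ** (D ** (?n *\<^sub>R G))) \<le> ?d * (c * spectral_norm (?n *\<^sub>R G))"
    by (intro order_trans[OF spectral_norm_mult_le] mult_left_mono mult_right_mono D spectral_norm_nonneg)
  moreover have "spectral_norm (lam *\<^sub>R (G' - G)) = lam * ?d"
    using lam by (simp add: spectral_norm_scaleR)
  ultimately show ?thesis unfolding eq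
    using spectral_norm_add_le[of "(?n *\<^sub>R G') ** (D ** (G' - G)) + (G' - G) ** (D ** (?n *\<^sub>R G))" "lam *\<^sub>R (G' - G)"]
      spectral_norm_add_le[of "(?n *\<^sub>R G') ** (D ** (G' - G))" "(G' - G) ** (D ** (?n *\<^sub>R G))"]
    by (simp add: algebra_simps)
qed

lemma feature_gram_eq:
  fixes ws :: "'m::finite \<Rightarrow> 'w"
  shows "feature_matrix \<phi> x ws ** transpose (feature_matrix \<phi> x ws) =
    (1 / real CARD('m)) *\<^sub>R (\<Sum>j\<in>UNIV. outer (\<chi> i. \<phi> (x i) (ws j)))"
proof -
  have "a / sqrt (real CARD('m)) * (b / sqrt (real CARD('m))) = (1 / real CARD('m)) * (a * b)" for a b
    by simp
  then show ?thesis
    by (simp only: vec_eq_iff feature_matrix_def outer_def matrix_matrix_mult_def transpose_def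
        vec_lambda_beta vector_scaleR_component sum_component sum_distrib_left real_scaleR_def simp_thms)
qed

text \<open>An error of \<open>\<epsilon> * \<gamma>\<close> keeps the form of \<open>Hh\<close>
  between \<open>(1 - \<epsilon>) * \<gamma>\<close> and \<open>(1 + \<epsilon>) * L\<close>. The
  upper end governs the decrease, the lower end the admissible step sizes.\<close>

lemma approximate_newton_step:
  fixes F :: "real^'n \<Rightarrow> real" and H Hh :: "real^'n^'n"
  assumes F_strong: "strongly_convex \<gamma> F" and F_smooth: "smooth L F" and \<gamma>: "0 < \<gamma>"
    and lower: "\<gamma> *\<^sub>R mat 1 \<preceq> H" and upper: "H \<preceq> L *\<^sub>R mat 1"
    and sym: "transpose Hh = Hh" and close: "spectral_norm (Hh - H) \<le> \<epsilon> * \<gamma>"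
    and \<epsilon>: "0 < \<epsilon>" "\<epsilon> < 1" and \<beta>: "0 < \<beta>" "\<beta> < 1"
  shows "rfn_update F \<beta> Hh w \<alpha> w' \<Longrightarrow>
      F w' - F v \<le> (1 - 2 * \<alpha> * \<beta> / ((1 + \<epsilon>) * (L / \<gamma>))) * (F w - F v)"
    and "0 < \<alpha> \<Longrightarrow> \<alpha> \<le> 2 * (1 - \<beta>) * (1 - \<epsilon>) / (L / \<gamma>) \<Longrightarrow>
      armijo F \<beta> w (newton_direction Hh (grad F w)) \<alpha>"
proof -
  have diff: "\<And>w. F differentiable (at w)" using F_smooth by (simp add: smooth_def)
  let ?g = "grad F w"
  define u where "u = matrix_inv Hh *v ?g"
  have dir: "newton_direction Hh ?g = - u" by (simp add: newton_direction_def u_def)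
  have H_lower: "\<gamma> * (norm v)\<^sup>2 \<le> v \<bullet> (H *v v)" for v
    using lower by (simp add: loewner_le_def psd_def matrix_vector_mult_diff_rdistrib inner_diff_right
        scaleR_matrix_vector_assoc[symmetric] power2_norm_eq_inner)
  have H_upper: "v \<bullet> (H *v v) \<le> L * (norm v)\<^sup>2" for v
    using upper by (simp add: loewner_le_def psd_def matrix_vector_mult_diff_rdistrib inner_diff_right
        scaleR_matrix_vector_assoc[symmetric] power2_norm_eq_inner)
  have \<gamma>L: "\<gamma> \<le> L" using H_lower[of "axis undefined 1"] H_upper[of "axis undefined 1"] by simp
  with \<gamma> have L: "0 < L" by simp
  have near: "\<bar>v \<bullet> (Hh *v v) - v \<bullet> (H *v v)\<bar> \<le> \<epsilon> * \<gamma> * (norm v)\<^sup>2" for v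
  proof -
    have "\<bar>v \<bullet> ((Hh - H) *v v)\<bar> \<le> spectral_norm (Hh - H) * (norm v)\<^sup>2"
      by (rule abs_dot_mult_le_spectral_norm)
    also have "\<dots> \<le> \<epsilon> * \<gamma> * (norm v)\<^sup>2" by (intro mult_right_mono close) auto
    finally show ?thesis by (simp add: matrix_vector_mult_diff_rdistrib inner_diff_right)
  qed
  have Hh_lower: "((1 - \<epsilon>) * \<gamma>) * (norm v)\<^sup>2 \<le> v \<bullet> (Hh *v v)" for v
    using near[of v] H_lower[of v] by (simp add: algebra_simps)
  have Hh_upper: "v \<bullet> (Hh *v v) \<le> ((1 + \<epsilon>) * L) * (norm v)\<^sup>2" for v
  proof -
    have "\<epsilon> * \<gamma> * (norm v)\<^sup>2 \<le> \<epsilon> * L * (norm v)\<^sup>2"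
      using \<epsilon> \<gamma>L by (intro mult_right_mono mult_left_mono) auto
    then show ?thesis using near[of v] H_upper[of v] by (simp add: algebra_simps)
  qed
  have pos: "0 < (1 - \<epsilon>) * \<gamma>" using \<epsilon> \<gamma> by simp
  note inv = symmetric_definite_inverse_bounds[OF sym pos Hh_lower Hh_upper, of ?g, folded u_def]
  \<comment> \<open>The squared gradient bounds the gap in \<open>F\<close>, and the upper bound on
    \<open>Hh\<close> turns it into the directional slope \<open>u \<bullet> ?g\<close>.\<close>
  have g_sq: "2 * \<gamma> * (F w - F v) \<le> (1 + \<epsilon>) * L * (u \<bullet> ?g)" for v
    using strongly_convex_gap_le_grad[OF F_strong diff \<gamma>, of w v] inv(3) by linarith
  have bL: "0 < (1 + \<epsilon>) * L" using \<epsilon> L by simp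
  show "F w' - F v \<le> (1 - 2 * \<alpha> * \<beta> / ((1 + \<epsilon>) * (L / \<gamma>))) * (F w - F v)"
    if upd: "rfn_update F \<beta> Hh w \<alpha> w'"
  proof -
    have \<alpha>: "0 < \<alpha>" and "F w' \<le> F w - \<alpha> * \<beta> * (u \<bullet> ?g)"
      using upd by (auto simp: rfn_update_def armijo_def dir)
    moreover have "2 * \<gamma> * (F w - F v) / ((1 + \<epsilon>) * L) \<le> u \<bullet> ?g"
      using g_sq[of v] bL by (simp add: pos_divide_le_eq mult.commute)
    then have "\<alpha> * \<beta> * (2 * \<gamma> * (F w - F v) / ((1 + \<epsilon>) * L)) \<le> \<alpha> * \<beta> * (u \<bullet> ?g)"
      using \<alpha> \<beta> by (intro mult_left_mono) auto
    moreover have "\<alpha> * \<beta> * (2 * \<gamma> * (F w - F v) / ((1 + \<epsilon>) * L)) =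
        2 * \<alpha> * \<beta> / ((1 + \<epsilon>) * (L / \<gamma>)) * (F w - F v)"
      by (simp add: mult_ac)
    ultimately show ?thesis by (simp add: left_diff_distrib)
  qed
  show "armijo F \<beta> w (newton_direction Hh ?g) \<alpha>"
    if \<alpha>: "0 < \<alpha>" and le: "\<alpha> \<le> 2 * (1 - \<beta>) * (1 - \<epsilon>) / (L / \<gamma>)"
  proof -
    \<comment> \<open>The bound on \<open>\<alpha>\<close> lets the quadratic term of the descent
      lemma consume at most the fraction \<open>1 - \<beta>\<close> of the linear decrease.\<close>
    have "\<alpha> * L \<le> 2 * (1 - \<beta>) * ((1 - \<epsilon>) * \<gamma>)"
      using le L by (simp add: pos_le_divide_eq mult_ac)
    then have "(\<alpha> * L) * (norm u)\<^sup>2 \<le> 2 * (1 - \<beta>) * ((1 - \<epsilon>) * \<gamma>) * (norm u)\<^sup>2"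
      by (intro mult_right_mono) auto
    also have "\<dots> \<le> 2 * (1 - \<beta>) * (u \<bullet> ?g)"
      unfolding mult.assoc[of "2 * (1 - \<beta>)"] using inv(2) \<beta> by (intro mult_left_mono) auto
    finally have "\<alpha> * ((\<alpha> * L) * (norm u)\<^sup>2) \<le> \<alpha> * (2 * (1 - \<beta>) * (u \<bullet> ?g))"
      using \<alpha> by (intro mult_left_mono) auto
    moreover have "F (w + \<alpha> *\<^sub>R (- u)) \<le> F w + (\<alpha> *\<^sub>R (- u)) \<bullet> ?g + L / 2 * (norm (\<alpha> *\<^sub>R (- u)))\<^sup>2"
      by (rule smooth_upper_bound[OF F_smooth])
    then have "F (w + \<alpha> *\<^sub>R (- u)) \<le> F w - \<alpha> * (u \<bullet> ?g) + \<alpha> * ((\<alpha> * L) * (norm u)\<^sup>2) / 2"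
      by (simp add: power_mult_distrib power2_eq_square mult_ac)
    ultimately show ?thesis
      by (simp add: armijo_def dir algebra_simps)
  qed
qed

section \<open>From kernel concentration to the convergence theorem\<close>

theorem theorem3:
  fixes x :: "'n::finite \<Rightarrow> real^'d::finite"
    and y :: "'n \<Rightarrow> 'y"
    and l l' l'' :: "'y \<Rightarrow> real \<Rightarrow> real"
    and lam \<mu> \<gamma> L lam1 \<kappa> \<beta> \<delta> \<epsilon> R \<delta>\<^sub>0 :: real
    and \<phi> :: "real^'d \<Rightarrow> real^'d \<Rightarrow> real"
    and p :: "real^'d \<Rightarrow> real"
    and K1 K :: "real^'n^'n"
    and D H :: "real^'n \<Rightarrow> real^'n^'n"
    and F :: "real^'n \<Rightarrow> real"
    and w_star w_t :: "real^'n"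
    and M :: "'s measure"
    and W :: "'m::finite \<Rightarrow> 's \<Rightarrow> real^'d"
    and Z :: "'s \<Rightarrow> real^'m^'n"
    and Kh :: "'s \<Rightarrow> real^'n^'n"
    and Hh :: "'s \<Rightarrow> real^'n \<Rightarrow> real^'n^'n"
    and \<zeta> :: "'s \<Rightarrow> real"
  assumes lam_pos: "0 < lam" and mu_pos: "0 < \<mu>"
    and loss_deriv: "\<And>a u. (l a has_real_derivative l' a u) (at u)"
    and loss_deriv2: "\<And>a u. (l' a has_real_derivative l'' a u) (at u)"
    and p_meas: "p \<in> borel_measurable borel"
    and p_nonneg: "\<And>\<omega>. 0 \<le> p \<omega>"
    and p_density: "(LINT \<omega>|lborel. p \<omega>) = 1"
    and phi_meas: "\<And>a. \<phi> a \<in> borel_measurable borel"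
    and phi_bound: "\<And>a \<omega>. \<bar>\<phi> a \<omega>\<bar> \<le> 1"
    and K1_eq: "K1 = kernel_matrix \<phi> p x"
    and K_eq: "K = K1 + \<mu> *\<^sub>R mat 1"
    and F_eq: "F = objective l y lam K"
    and D_eq: "D = loss_diag l'' y K"
    and H_eq: "H = (\<lambda>w. hessian_form lam (D w) K)"
    and F_diff: "\<And>w. F differentiable (at w)"
    and F_diff2: "\<And>w. grad F differentiable (at w)"
    and gamma_pos: "0 < \<gamma>"
    and F_strong: "strongly_convex \<gamma> F"
    and F_smooth: "smooth L F"
    and H_lower: "\<And>w. \<gamma> *\<^sub>R mat 1 \<preceq> H w"
    and H_upper: "\<And>w. H w \<preceq> L *\<^sub>R mat 1"
    and D_bound: "\<And>w. spectral_norm (D w) \<le> lam1"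
    and kappa_eq: "\<kappa> = L / \<gamma>"
    and w_star: "is_arg_min F (\<lambda>_. True) w_star"
    and delta: "0 < \<delta>" "\<delta> < 1"
    and eps: "0 < \<epsilon>" "\<epsilon> < 1"
    and beta: "0 < \<beta>" "\<beta> < 1"
    and M_prob: "prob_space M"
    and W_indep: "prob_space.indep_vars M (\<lambda>_. borel) W UNIV"
    and W_dist: "\<And>j. distributed M lborel (W j) (\<lambda>\<omega>. ennreal (p \<omega>))"
    and Z_eq: "Z = (\<lambda>s. feature_matrix \<phi> x (\<lambda>j. W j s))"
    and Kh_eq: "Kh = (\<lambda>s. Z s ** transpose (Z s) + \<mu> *\<^sub>R mat 1)"
    and Hh_eq: "Hh = (\<lambda>s w. hessian_form lam (D w) (Kh s))"
    and zeta_eq: "\<zeta> = (\<lambda>s. lam + lam1 * spectral_norm ((1 / real CARD('n)) *\<^sub>R Kh s)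
                           + lam1 * spectral_norm ((1 / real CARD('n)) *\<^sub>R (K1 + \<mu> *\<^sub>R mat 1)))"
    and ratio_bound: "\<mu> / spectral_norm K1 \<le> R"
    and delta_bound: "\<delta> \<le> \<delta>\<^sub>0" "\<delta>\<^sub>0 < 1"
  shows "\<exists>E \<in> sets M. measure M E \<ge> 1 - \<delta> \<and>
    (\<forall>s \<in> E.
       real CARD('m) \<ge> omega_const R \<delta>\<^sub>0 *
         ((\<zeta> s)\<^sup>2 * real CARD('n) * spectral_norm K1 / (\<epsilon>\<^sup>2 * \<gamma>\<^sup>2) *
          ln (trace K1 / (spectral_norm K1 * \<delta>))) \<longrightarrow>
       (\<forall>\<alpha> w_next. rfn_update F \<beta> (Hh s w_t) w_t \<alpha> w_next \<longrightarrow>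
          F w_next - F w_star \<le> (1 - 2 * \<alpha> * \<beta> / ((1 + \<epsilon>) * \<kappa>)) * (F w_t - F w_star)) \<and>
       (\<forall>\<alpha>. 0 < \<alpha> \<and> \<alpha> \<le> 2 * (1 - \<beta>) * (1 - \<epsilon>) / \<kappa> \<longrightarrow>
          armijo F \<beta> w_t (newton_direction (Hh s w_t) (grad F w_t)) \<alpha>))"
proof -
  interpret M: prob_space M by (rule M_prob)
  \<comment> \<open>The common law of the random features; \<open>K1\<close> becomes the second
    moment matrix of the abstract setting.\<close>
  define Q where "Q = density lborel (\<lambda>\<omega>. ennreal (p \<omega>))"
  define z where "z = (\<lambda>\<omega>. \<chi> i. \<phi> (x i) \<omega>)"
  have setsQ [measurable_cong]: "sets Q = sets borel" by (simp add: Q_def)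
  have W_meas [measurable]: "W j \<in> M \<rightarrow>\<^sub>M borel" for j
    using W_indep unfolding M.indep_vars_def by simp
  have distr_Q: "distr M Q (W j) = Q" for j
  proof -
    have "distr M Q (W j) = distr M lborel (W j)" by (intro distr_cong) (auto simp: setsQ)
    also have "\<dots> = Q" unfolding Q_def by (rule distributed_distr_eq_density[OF W_dist])
    finally show ?thesis .
  qed
  have Q: "prob_space Q"
    using M.prob_space_distr[of "W undefined" Q] unfolding distr_Q by measurable
  interpret Q: random_features Q z K1
  proof (intro random_features.intro random_features_axioms.intro Q)
    show "z \<in> borel_measurable Q"
      unfolding z_def measurable_cong_sets[OF setsQ refl]
      by (intro borel_measurable_vec_lambda phi_meas)
    show "\<bar>z \<omega> $ i\<bar> \<le> 1" for \<omega> i by (simp add: z_def phi_bound)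
    note [measurable] = phi_meas p_meas
    show "K1 $ i $ j = (\<integral>\<omega>. z \<omega> $ i * z \<omega> $ j \<partial>Q)" for i j
      unfolding Q_def by (subst integral_density)
        (auto simp: K1_eq kernel_matrix_def kernel1_def z_def p_nonneg mult_ac)
  qed
  have indep: "M.indep_vars (\<lambda>_. Q) W UNIV"
    using M.indep_vars_compose2[OF W_indep, of "\<lambda>_ \<omega>. \<omega>" "\<lambda>_. Q"]
    by (simp add: measurable_cong_sets[OF refl setsQ])
  let ?m = "real CARD('m)" and ?n = "real CARD('n)"
  define N where "N = spectral_norm K1"
  have N0: "0 \<le> N" unfolding N_def by (rule spectral_norm_nonneg)
  have "0 \<le> \<mu> / N" using mu_pos N0 by simp
  then have R0: "0 \<le> R" using ratio_bound unfolding N_def by linarith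
  have lam1: "0 \<le> lam1" using D_bound[of w_t] spectral_norm_nonneg[of "D w_t"] by linarith
  have \<zeta>0: "0 < \<zeta> s" for s
    unfolding zeta_eq using lam_pos lam1 spectral_norm_nonneg by (intro add_pos_nonneg mult_nonneg_nonneg) auto
  \<comment> \<open>The shifts by \<open>\<mu>\<close> cancel, leaving the centered sum divided by
    the sample size.\<close>
  have diff: "Kh s - K = (1 / ?m) *\<^sub>R Q.centered_sum (\<chi> j. z (W j s))" for s
    unfolding Kh_eq Z_eq K_eq feature_gram_eq Q.centered_sum_def z_def
    by (simp add: sum_subtractf sum_constant_scaleR scaleR_diff_right del: sum_constant)
  have symKh: "transpose (Kh s) = Kh s" for s
    by (simp add: Kh_eq transpose_scalar transpose_add matrix_transpose_mul)
  have symD: "transpose (D w) = D w" for w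
    by (simp add: D_eq loss_diag_def transpose_def vec_eq_iff)
  have symHh: "transpose (Hh s w) = Hh s w" for s w
    by (simp add: Hh_eq hessian_form_def transpose_scalar transpose_add matrix_transpose_mul
        symD symKh matrix_mul_assoc)
  \<comment> \<open>The Hessian expression vanishes at the zero Gram matrix, so the perturbation
    bound against zero controls the form of \<open>H w_t\<close> at a unit vector, which is at least
    \<open>\<gamma>\<close>.\<close>
  have \<gamma>_le: "\<gamma> \<le> \<zeta> s * spectral_norm K" for s
  proof -
    let ?v = "axis undefined 1 :: real^'n"
    have "\<gamma> \<le> ?v \<bullet> (H w_t *v ?v)"
      using H_lower[of w_t] unfolding loewner_le_def psd_def
      by (auto simp: matrix_vector_mult_diff_rdistrib inner_diff_right
        scaleR_matrix_vector_assoc[symmetric] dest!: spec[of _ ?v])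
    also have "\<dots> \<le> spectral_norm (H w_t - hessian_form lam (D w_t) 0)"
      using abs_dot_mult_le_spectral_norm[of ?v "H w_t"] by (simp add: hessian_form_def)
    also have "\<dots> \<le> (lam + lam1 * spectral_norm ((1 / ?n) *\<^sub>R K)
        + lam1 * spectral_norm ((1 / ?n) *\<^sub>R (0::real^'n^'n))) * spectral_norm (K - 0)"
      unfolding H_eq using lam_pos by (intro hessian_form_diff_le D_bound) auto
    also have "\<dots> \<le> \<zeta> s * spectral_norm K"
      unfolding zeta_eq K_eq[symmetric] using lam1 spectral_norm_nonneg[of "(1 / ?n) *\<^sub>R Kh s"]
      by (intro mult_mono) (auto simp: spectral_norm_nonneg spectral_norm_eq_0[THEN iffD2] intro!: add_nonneg_nonneg lam_pos[THEN less_imp_le])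
    finally show ?thesis .
  qed
  have \<gamma>_le_N: "\<gamma> \<le> \<zeta> s * ((1 + R) * N)" if "N \<noteq> 0" for s
  proof -
    have "\<mu> \<le> R * N" using ratio_bound N0 that unfolding N_def by (simp add: pos_divide_le_eq)
    moreover have "spectral_norm K \<le> N + \<mu>"
    proof -
      have "spectral_norm (\<mu> *\<^sub>R (mat 1 :: real^'n^'n)) \<le> \<mu>"
        using mu_pos spectral_norm_mat_1_le by (simp add: spectral_norm_scaleR)
      then show ?thesis
        using spectral_norm_add_le[of K1 "\<mu> *\<^sub>R mat 1"] unfolding K_eq N_def by linarith
    qed
    ultimately have "spectral_norm K \<le> (1 + R) * N" by (simp add: algebra_simps)
    then have "\<zeta> s * spectral_norm K \<le> \<zeta> s * ((1 + R) * N)"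
      using \<zeta>0[of s] by (intro mult_left_mono) auto
    with \<gamma>_le[of s] show ?thesis by linarith
  qed
  \<comment> \<open>\<open>S\<close> is fixed before \<open>\<tau>\<close>, so the accuracy may
    depend on \<open>s\<close> through \<open>\<zeta> s\<close>.\<close>
  obtain S where S: "S \<in> sets M" "measure M S \<ge> 1 - \<delta>"
    and conc: "\<And>s \<tau>. s \<in> S \<Longrightarrow> 0 < \<tau> \<Longrightarrow> (spectral_norm K1 \<noteq> 0 \<Longrightarrow> \<tau> \<le> (1 + R) * spectral_norm K1) \<Longrightarrow>
      ?m \<ge> 100 * (1 + R) * (1 + 1 / ln (1 / \<delta>\<^sub>0)) *
        (?n * spectral_norm K1 / \<tau>\<^sup>2 * ln (trace K1 / (spectral_norm K1 * \<delta>))) \<Longrightarrow>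
      spectral_norm (Q.centered_sum (\<chi> j. z (W j s))) \<le> ?m * \<tau>"
    using Q.empirical_kernel_concentration[OF M_prob indep distr_Q delta(1) delta_bound, of "1 + R"] R0
    by auto
  have close: "spectral_norm (Hh s w_t - H w_t) \<le> \<epsilon> * \<gamma>"
    if s: "s \<in> S" and m: "?m \<ge> omega_const R \<delta>\<^sub>0 *
         ((\<zeta> s)\<^sup>2 * ?n * spectral_norm K1 / (\<epsilon>\<^sup>2 * \<gamma>\<^sup>2) *
          ln (trace K1 / (spectral_norm K1 * \<delta>)))" for s
  proof -
    define \<tau> where "\<tau> = \<epsilon> * \<gamma> / \<zeta> s"
    have \<tau>0: "0 < \<tau>" unfolding \<tau>_def using eps gamma_pos \<zeta>0 by simp
    have "\<tau> \<le> (1 + R) * spectral_norm K1" if "spectral_norm K1 \<noteq> 0"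
    proof -
      have "\<epsilon> * \<gamma> \<le> 1 * \<gamma>" using eps gamma_pos by (intro mult_right_mono) auto
      then have "\<epsilon> * \<gamma> \<le> ((1 + R) * N) * \<zeta> s" using \<gamma>_le_N[of s] that by (simp add: N_def mult.commute)
      then show ?thesis unfolding \<tau>_def using \<zeta>0[of s] by (simp add: pos_divide_le_eq N_def)
    qed
    \<comment> \<open>With this \<open>\<tau>\<close> the sample size condition is exactly the one
      in \<open>conc\<close>.\<close>
    moreover have "(\<zeta> s)\<^sup>2 * ?n * spectral_norm K1 / (\<epsilon>\<^sup>2 * \<gamma>\<^sup>2) = ?n * spectral_norm K1 / \<tau>\<^sup>2"
      by (simp add: \<tau>_def power_divide power_mult_distrib mult_ac)
    ultimately have "spectral_norm (Q.centered_sum (\<chi> j. z (W j s))) \<le> ?m * \<tau>"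
      using m by (intro conc s \<tau>0) (auto simp: omega_const_def)
    then have "spectral_norm (Kh s - K) \<le> \<tau>"
      unfolding diff spectral_norm_scaleR by (simp add: pos_divide_le_eq mult.commute)
    then have "\<zeta> s * spectral_norm (Kh s - K) \<le> \<zeta> s * \<tau>"
      using \<zeta>0[of s] by (intro mult_left_mono) auto
    also have "\<dots> = \<epsilon> * \<gamma>" unfolding \<tau>_def using \<zeta>0[of s] by simp
    finally have "\<zeta> s * spectral_norm (Kh s - K) \<le> \<epsilon> * \<gamma>" .
    moreover have "spectral_norm (Hh s w_t - H w_t) \<le> \<zeta> s * spectral_norm (Kh s - K)"
      unfolding Hh_eq H_eq zeta_eq K_eq[symmetric] using lam_pos
      by (intro hessian_form_diff_le D_bound) auto
    ultimately show ?thesis by linarith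
  qed
  show ?thesis
  proof (intro bexI[of _ S] conjI ballI impI allI S)
    fix s assume s: "s \<in> S"
      "?m \<ge> omega_const R \<delta>\<^sub>0 *
         ((\<zeta> s)\<^sup>2 * ?n * spectral_norm K1 / (\<epsilon>\<^sup>2 * \<gamma>\<^sup>2) *
          ln (trace K1 / (spectral_norm K1 * \<delta>)))"
    note step = approximate_newton_step[OF F_strong F_smooth gamma_pos H_lower H_upper symHh
        close[OF s] eps beta, folded kappa_eq]
    show "F w_next - F w_star \<le> (1 - 2 * \<alpha> * \<beta> / ((1 + \<epsilon>) * \<kappa>)) * (F w_t - F w_star)"
      if "rfn_update F \<beta> (Hh s w_t) w_t \<alpha> w_next" for \<alpha> w_next
      by (rule step(1)[OF that])
    show "armijo F \<beta> w_t (newton_direction (Hh s w_t) (grad F w_t)) \<alpha>"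
      if "0 < \<alpha> \<and> \<alpha> \<le> 2 * (1 - \<beta>) * (1 - \<epsilon>) / \<kappa>" for \<alpha>
      using that by (intro step(2)) auto
  qed
qed

end
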